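(* For every positive integer $k$ there is a constant $c_k$ depending only on $k$ such that, for every positive integer $n$, every $n$-vertex simple topological graph without a topological subgraph weakly isomorphic to $C_{k,k}$ has at most $c_k\, n^{2-\epsilon(k)}$ edges, where $\epsilon(k) = \left(2(k-1)^4+1\right)^{-1}$.
   Context: A topological graph is a (finite) graph drawn in the plane such that its vertices are represented by points and its edges by non-self-intersecting arcs connecting the corresponding points. No edge passes through a point representing a vertex other than its endpoints. Tangencies between edges are not allowed: if two edges share an interior point, they properly cross at this point. A topological graph is simple if every pair of its edges intersect at most once: at a common endpoint or at a proper crossing. A topological graph $H$ is a topological subgraph of $G$ if $V(H)\subset V(G)$ and $E(H)\subset E(G)$ (with the same drawing). Two topological graphs $G$ and $H$ are weakly isomorphic if there is an incidence preserving bijection between the vertices and edges of $G$ and those of $H$ such that two edges of $G$ cross if and only if the corresponding edges of $H$ cross. $C_{s,t}$ denotes the complete bipartite topological graph with straight-line edges whose $s$ vertices of one class lie on the $y$-axis and whose $t$ vertices of the other class lie on the vertical line $x=1$, with all $st$ straight-line segments between the classes drawn as edges (up to weak isomorphism this does not depend on the exact placement of the vertices on these lines). *)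

theory Defs
  imports "HOL-Analysis.Analysis"
begin

text \<open>The plane is \<^typ>\<open>complex\<close>. A vertex is identified with the point representing it and an
  edge with the arc representing it, taken as a set of points. The endpoints of an arc are
  determined by this set, and distinct (even parallel) edges of a topological graph are drawn as
  different sets, since no two edges may overlap; so no information is lost.\<close>

record topgraph =
  verts :: "complex set"
  edges :: "complex set set"

text \<open>Two curves cross properly at \<open>p\<close> if a homeomorphism from a neighbourhood of \<open>p\<close> onto the open
  unit disc carries them to the two coordinate axes. In particular \<open>p\<close> is an endpoint of neither
  curve, and tangencies and overlaps are excluded.\<close>

definition proper_crossing :: "complex set \<Rightarrow> complex set \<Rightarrow> complex \<Rightarrow> bool" where
  "proper_crossing A B p \<longleftrightarrow>
     (\<exists>U h h'. open U \<and> p \<in> U \<and> homeomorphism U (ball 0 1) h h' \<and> h p = 0 \<and>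
        h ` (A \<inter> U) = {z \<in> ball 0 1. Im z = 0} \<and>
        h ` (B \<inter> U) = {z \<in> ball 0 1. Re z = 0})"

definition edges_cross :: "complex set \<Rightarrow> complex set \<Rightarrow> bool" where
  "edges_cross e f \<longleftrightarrow> (\<exists>p. proper_crossing e f p)"

text \<open>\<^const>\<open>arc\<close> means continuous and injective, so there are no loops. The equation for
  \<open>e \<inter> verts G\<close> says both that the endpoints of \<open>e\<close> are vertices and that \<open>e\<close> passes through no
  other vertex; hence a vertex \<open>v\<close> is incident with \<open>e\<close> iff \<open>v \<in> e\<close>.\<close>

definition topological_graph :: "topgraph \<Rightarrow> bool" where
  "topological_graph G \<longleftrightarrow>
     finite (verts G) \<and> finite (edges G) \<and>
     (\<forall>e\<in>edges G. \<exists>g. arc g \<and> path_image g = e \<and> e \<inter> verts G = {pathstart g, pathfinish g}) \<and>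
     (\<forall>e\<in>edges G. \<forall>f\<in>edges G. e \<noteq> f \<longrightarrow> (\<forall>p \<in> e \<inter> f - verts G. proper_crossing e f p))"

text \<open>Any common point of two edges of a topological graph is a common endpoint or a proper
  crossing, so it remains to bound the number of common points.\<close>

definition simple_topological_graph :: "topgraph \<Rightarrow> bool" where
  "simple_topological_graph G \<longleftrightarrow>
     topological_graph G \<and>
     (\<forall>e\<in>edges G. \<forall>f\<in>edges G. e \<noteq> f \<longrightarrow> (\<forall>p \<in> e \<inter> f. \<forall>q \<in> e \<inter> f. p = q))"

definition topological_subgraph :: "topgraph \<Rightarrow> topgraph \<Rightarrow> bool" where
  "topological_subgraph H G \<longleftrightarrow>
     topological_graph H \<and> topological_graph G \<and> verts H \<subseteq> verts G \<and> edges H \<subseteq> edges G"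

definition weakly_isomorphic :: "topgraph \<Rightarrow> topgraph \<Rightarrow> bool" where
  "weakly_isomorphic G H \<longleftrightarrow>
     (\<exists>\<phi> \<psi>. bij_betw \<phi> (verts G) (verts H) \<and> bij_betw \<psi> (edges G) (edges H) \<and>
        (\<forall>v\<in>verts G. \<forall>e\<in>edges G. v \<in> e \<longleftrightarrow> \<phi> v \<in> \<psi> e) \<and>
        (\<forall>e\<in>edges G. \<forall>f\<in>edges G. e \<noteq> f \<longrightarrow> (edges_cross e f \<longleftrightarrow> edges_cross (\<psi> e) (\<psi> f))))"

definition straight_bipartite :: "real set \<Rightarrow> real set \<Rightarrow> topgraph" where
  "straight_bipartite Y Z =
     \<lparr> verts = Complex 0 ` Y \<union> Complex 1 ` Z,
       edges = {closed_segment (Complex 0 y) (Complex 1 z) | y z. y \<in> Y \<and> z \<in> Z} \<rparr>"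

text \<open>The graph \<open>C\<^bsub>s,t\<^esub>\<close>. The heights of the vertices on the two lines are irrelevant up to weak
  isomorphism; they are fixed to be \<open>0, 1, 2, \<dots>\<close>. Several edges may then be concurrent, which
  affects neither the definition of a topological graph nor weak isomorphism.\<close>

definition C_graph :: "nat \<Rightarrow> nat \<Rightarrow> topgraph" where
  "C_graph s t = straight_bipartite (real ` {..<s}) (real ` {..<t})"

end

theory Submission
  imports Defs "HOL-Library.Ramsey"
begin

text \<open>
  By the theorem of Kovari, Sos and Turan (\<open>kovari_sos_turan\<close>), a graph with \<open>n\<close> vertices and
  more than \<open>C n\<^bsup>2-1/s\<^esup>\<close> edges contains a complete bipartite graph with \<open>s\<close> vertices in one
  class \<open>A\<close> and as many as desired in the other class \<open>B\<close>. With \<open>s = 2 (k - 1)\<^sup>4 + 1\<close> it is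
  enough to find \<open>C\<^bsub>k,k\<^esub>\<close> in every simple drawing of such a graph. Enumerate \<open>B\<close> and colour each
  pair \<open>i < j\<close> by the set of all \<open>(a, a')\<close> such that the edge \<open>a b\<^sub>i\<close> crosses the edge
  \<open>a' b\<^sub>j\<close>. Ramsey's theorem yields a large part of \<open>B\<close> on which this colour is one fixed relation
  \<open>c\<close> on \<open>A\<close>. Since edges with a common endpoint do not cross, \<open>c\<close> describes all crossings, and
  the aim is a set of \<open>k\<close> vertices of \<open>A\<close> on which \<open>c\<close> is a strict linear order: that is exactly
  the crossing pattern of straight edges between two parallel lines.

  Three facts about simple drawings restrict \<open>c\<close>.

  \<^item> \<open>c\<close> is antisymmetric, because a simple drawing of the 4-cycle cannot have crossings in both
    pairs of opposite edges (\<open>no_thrackle_C4\<close>).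

  \<^item> Among any three vertices of \<open>A\<close> two are related by \<open>c\<close> in one of the two directions, because
    \<open>K\<^bsub>3,3\<^esub>\<close> has no drawing without crossings (\<open>no_plane_K33\<close>).

  \<^item> \<open>c\<close> has no cyclic triple: two stars with the same three leaves cannot cross cyclically
    (\<open>no_cyclic_tripods\<close>).

  By the second fact the graph of related pairs has no independent triple, so any \<open>k (k + 1) / 2\<close>
  vertices of \<open>A\<close> contain \<open>k\<close> pairwise related ones; on these \<open>c\<close> is a tournament without cyclic
  triples, that is, a strict linear order. Finally \<open>k (k + 1) / 2 \<le> 2 (k - 1)\<^sup>4 + 1\<close>.

  The three topological facts rest on the Jordan curve theorem through three lemmas.
  \<open>theta_curve_separates\<close>: a point off a theta curve cannot reach all three of its arcs without
  meeting the other two. \<open>crossing_corner\<close>: if a set leaves a proper crossing free of two adjacent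
  branches, these branches lie in one component of its complement. \<open>crossing_separates\<close>: an arc
  that crosses a Jordan curve exactly once, and properly, joins its two sides.
\<close>

section \<open>Arcs, Jordan curves and theta curves\<close>

text \<open>
  Arcs are handled as point sets with named endpoints, as in the definition of a topological
  graph, so that cutting and gluing become statements about unions and intersections.
\<close>

definition arc_between :: "complex set \<Rightarrow> complex \<Rightarrow> complex \<Rightarrow> bool" where
  "arc_between e a b \<longleftrightarrow> (\<exists>g. arc g \<and> path_image g = e \<and> pathstart g = a \<and> pathfinish g = b)"

lemma arc_between_sym: "arc_between e a b \<Longrightarrow> arc_between e b a"
  unfolding arc_between_def
  by (metis arc_reversepath path_image_reversepath pathfinish_reversepath pathstart_reversepath)

lemma arc_between_facts:
  assumes "arc_between e a b"
  shows arc_between_ends: "a \<in> e" "b \<in> e" "a \<noteq> b"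
    and arc_between_compact: "compact e"
    and arc_between_closed: "closed e"
    and arc_between_connected: "connected e"
  using assms unfolding arc_between_def
  by (auto dest: arc_distinct_ends simp: pathfinish_in_path_image pathstart_in_path_image
      compact_arc_image closed_arc_image connected_arc_image)

lemma arc_between_connected_minus_end:
  assumes "arc_between e a b"
  shows "connected (e - {a})"
proof -
  obtain g where g: "arc g" "path_image g = e" "pathstart g = a" "pathfinish g = b"
    using assms by (auto simp: arc_between_def)
  have inj: "inj_on g {0..1}" and cont: "continuous_on {0..1} g"
    using g(1) by (auto simp: arc_def path_def)
  have "e - {a} = g ` {0<..1}"
  proof -
    have "g ` {0<..1} = g ` ({0..1} - {0})"
      by (rule arg_cong[where f="image g"]) auto
    also have "\<dots> = g ` {0..1} - {g 0}"
      using inj by (subst inj_on_image_set_diff[OF inj]) auto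
    finally show ?thesis using g by (simp add: path_image_def pathstart_def)
  qed
  moreover have "connected (g ` {0<..1})"
    by (intro connected_continuous_image continuous_on_subset[OF cont]) auto
  ultimately show ?thesis by simp
qed

lemma arc_between_connected_minus_ends:
  assumes "arc_between e a b"
  shows "connected (e - {a, b})"
  using assms connected_simple_path_endless arc_imp_simple_path
  unfolding arc_between_def by metis

lemma arc_between_join:
  assumes "arc_between e a x" "arc_between f x b" "e \<inter> f = {x}"
  shows "arc_between (e \<union> f) a b"
proof -
  obtain g where g: "arc g" "path_image g = e" "pathstart g = a" "pathfinish g = x"
    using assms by (auto simp: arc_between_def)
  obtain h where h: "arc h" "path_image h = f" "pathstart h = x" "pathfinish h = b"
    using assms by (auto simp: arc_between_def)
  have "arc (g +++ h)" using arc_join[OF g(1) h(1)] g h assms by auto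
  then show ?thesis unfolding arc_between_def
    by (intro exI[of _ "g +++ h"]) (use g h in \<open>auto simp: path_image_join\<close>)
qed

lemma arc_between_split:
  assumes "arc_between e a b" "x \<in> e" "x \<noteq> a" "x \<noteq> b"
  obtains e1 e2 where "arc_between e1 a x" "arc_between e2 x b" "e = e1 \<union> e2" "e1 \<inter> e2 = {x}"
proof -
  obtain g where g: "arc g" "path_image g = e" "pathstart g = a" "pathfinish g = b"
    using assms by (auto simp: arc_between_def)
  obtain t where t: "t \<in> {0..1}" "g t = x" using g(2) assms(2) by (auto simp: path_image_def)
  have t0: "t \<noteq> 0" "t \<noteq> 1" using t g assms by (auto simp: pathstart_def pathfinish_def)
  have inj: "inj_on g {0..1}" using g by (auto simp: arc_def)
  have ends: "g 0 = a" "g 1 = b" using g by (auto simp: pathstart_def pathfinish_def)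
  have sub0: "arc (subpath 0 t g)" "path_image (subpath 0 t g) = g ` {0..t}"
    "pathstart (subpath 0 t g) = a" "pathfinish (subpath 0 t g) = x"
    using arc_subpath_arc[OF g(1), of 0 t] t t0 ends by (simp_all add: path_image_subpath)
  have subt: "arc (subpath t 1 g)" "path_image (subpath t 1 g) = g ` {t..1}"
    "pathstart (subpath t 1 g) = x" "pathfinish (subpath t 1 g) = b"
    using arc_subpath_arc[OF g(1), of t 1] t t0 ends by (simp_all add: path_image_subpath)
  show thesis
  proof
    show "arc_between (g ` {0..t}) a x"
      unfolding arc_between_def
      using sub0 by (intro exI[of _ "subpath 0 t g"]) simp
    show "arc_between (g ` {t..1}) x b"
      unfolding arc_between_def
      using subt by (intro exI[of _ "subpath t 1 g"]) simp
    have "{0..1} = {0..t} \<union> {t..1}" using t by auto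
    then show "e = g ` {0..t} \<union> g ` {t..1}"
      using g(2) by (simp add: path_image_def image_Un)
    have "g ` {0..t} \<inter> g ` {t..1} = g ` ({0..t} \<inter> {t..1})"
      using t by (intro inj_on_image_Int[OF inj, symmetric]) auto
    also have "{0..t} \<inter> {t..1} = {t}" using t by auto
    finally show "g ` {0..t} \<inter> g ` {t..1} = {x}" using t by simp
  qed
qed

lemma arc_between_start_limpt:
  assumes "arc_between e x b"
  shows "x islimpt e"
  using connected_imp_perfect[OF arc_between_connected[OF assms], of x] arc_between_ends[OF assms]
  by blast

definition jordan_curve :: "complex set \<Rightarrow> bool" where
  "jordan_curve J \<longleftrightarrow> (\<exists>c. simple_path c \<and> pathfinish c = pathstart c \<and> path_image c = J)"

lemma jordan_curve_join:
  assumes "arc_between e a b" "arc_between f a b" "e \<inter> f = {a, b}"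
  shows "jordan_curve (e \<union> f)"
proof -
  obtain g where g: "arc g" "path_image g = e" "pathstart g = a" "pathfinish g = b"
    using assms by (auto simp: arc_between_def)
  obtain h where h: "arc h" "path_image h = f" "pathstart h = b" "pathfinish h = a"
    using assms(2)[THEN arc_between_sym] by (auto simp: arc_between_def)
  have "simple_path (g +++ h)"
    using simple_path_join_loop[OF g(1) h(1)] g h assms by auto
  then show ?thesis unfolding jordan_curve_def
    by (intro exI[of _ "g +++ h"]) (use g h in \<open>auto simp: path_image_join\<close>)
qed

text \<open>
  For a Jordan curve \<open>J\<close> and a point \<open>q\<close> off \<open>J\<close> this is the component of the complement that
  does not contain \<open>q\<close>. Naming the sides relative to a point keeps the later arguments symmetric:
  it does not matter which of them is bounded.
\<close>

definition opposite_side :: "complex set \<Rightarrow> complex \<Rightarrow> complex set" where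
  "opposite_side J q = {z. z \<notin> J \<and> \<not> connected_component (-J) z q}"

lemma opposite_side:
  assumes "jordan_curve J" "q \<notin> J"
  shows opposite_side_nonempty: "opposite_side J q \<noteq> {}"
    and opposite_side_connected: "connected (opposite_side J q)"
    and opposite_side_frontier: "frontier (opposite_side J q) = J"
proof -
  obtain c where c: "simple_path c" "pathfinish c = pathstart c" "path_image c = J"
    using assms by (auto simp: jordan_curve_def)
  define I where "I = inside J"
  define X where "X = outside J"
  have *: "I \<noteq> {}" "open I" "connected I" "X \<noteq> {}" "open X" "connected X" "I \<inter> X = {}"
    "I \<union> X = -J" "frontier I = J" "frontier X = J"
    using Jordan_inside_outside[OF c(1,2)] c(3) by (auto simp: I_def X_def)
  have other: "opposite_side J q = D"
    if D: "open D" "connected D" "open E" "connected E" "D \<inter> E = {}" "D \<union> E = -J" "q \<in> E" for D E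
  proof -
    have "\<not> connected_component (-J) z q" if z: "z \<in> D" for z
    proof
      assume "connected_component (-J) z q"
      then obtain T where T: "connected T" "T \<subseteq> -J" "z \<in> T" "q \<in> T"
        by (auto simp: connected_component_def)
      have "D \<inter> T \<noteq> {}" "E \<inter> T \<noteq> {}" "D \<inter> E \<inter> T = {}" "T \<subseteq> D \<union> E" using T z D by blast+
      then show False using connectedD[OF T(1) D(1) D(3)] by blast
    qed
    moreover have "connected_component (-J) z q" if "z \<in> E" for z
      unfolding connected_component_def using D(4,6,7) that by blast
    ultimately show ?thesis using D(5,6) unfolding opposite_side_def by blast
  qed
  have "opposite_side J q = I \<or> opposite_side J q = X"
  proof (cases "q \<in> I")
    case True
    have "opposite_side J q = X" by (rule other[of X I]) (use * True in auto)
    then show ?thesis ..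
  next
    case False
    have "opposite_side J q = I" by (rule other[of I X]) (use * False assms in auto)
    then show ?thesis ..
  qed
  then show "opposite_side J q \<noteq> {}" "connected (opposite_side J q)"
    "frontier (opposite_side J q) = J"
    using * by auto
qed

lemma connected_in_opposite_side:
  assumes "connected D" "D \<inter> J = {}" "z \<in> D" "z \<in> opposite_side J q"
  shows "D \<subseteq> opposite_side J q"
proof
  fix y assume y: "y \<in> D"
  have "connected_component (-J) z y"
    unfolding connected_component_def using assms y by blast
  then have "\<not> connected_component (-J) y q"
    using assms(4) connected_component_trans by (fastforce simp: opposite_side_def)
  then show "y \<in> opposite_side J q"
    using y assms(2) by (auto simp: opposite_side_def)
qed

text \<open>
  An open arc that misses \<open>K\<close> lies in one component of the complement, so it is enough that \<open>q\<close>
  reaches one of its points.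
\<close>

lemma open_arc_same_component:
  assumes "arc_between P a b" "P \<inter> K \<subseteq> {a,b}" "{a,b} \<subseteq> K" "x \<in> P" "y \<in> P - {a,b}"
    "connected_component (-K) q x"
  shows "connected_component (-K) y q"
proof -
  have "x \<notin> K" using connected_component_in[OF assms(6)] by blast
  then have "x \<in> P - {a,b}" using assms by blast
  moreover have "P - {a,b} \<subseteq> -K" using assms by blast
  ultimately have "connected_component (-K) y x"
    using arc_between_connected_minus_ends[OF assms(1)] assms(5)
    unfolding connected_component_def by blast
  then show ?thesis
    by (rule connected_component_trans[OF _ connected_component_sym[OF assms(6)]])
qed

text \<open>
  A face of a theta curve is bounded by only two of its three arcs, so a point \<open>q\<close> in a face is cut
  off from the third arc by the other two. For the proof, suppose that none of the three cycles
  separates \<open>q\<close> from the remaining arc. Then the side of \<open>P1 \<union> P2\<close> opposite to \<open>q\<close> avoids \<open>P3\<close>. By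
  Janiszewski's theorem a point \<open>z\<close> of it must also be separated from \<open>q\<close> by a second cycle, as two
  cycles that do not separate meet in an arc and so neither does their union. The two opposite
  sides containing \<open>z\<close> are connected and avoid the whole theta curve, hence are equal; but then so
  are their frontiers, the two cycles.
\<close>

lemma theta_curve_separates:
  assumes arcs: "arc_between P1 a b" "arc_between P2 a b" "arc_between P3 a b"
    and disj: "P1 \<inter> P2 = {a,b}" "P1 \<inter> P3 = {a,b}" "P2 \<inter> P3 = {a,b}"
    and q: "q \<notin> P1 \<union> P2 \<union> P3"
    and x: "x1 \<in> P1" "x2 \<in> P2" "x3 \<in> P3"
    and c1: "connected_component (-(P2 \<union> P3)) q x1"
    and c2: "connected_component (-(P1 \<union> P3)) q x2"
    and c3: "connected_component (-(P1 \<union> P2)) q x3"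
  shows False
proof -
  \<comment> \<open>The contradiction once \<open>z\<close> is separated from \<open>q\<close> by two of the cycles; the pair of cycles is
    left open, since it may be either of two.\<close>
  have key: False
    if arcs: "arc_between P1 a b" "arc_between P2 a b" "arc_between P3 a b"
    and disj: "P1 \<inter> P2 = {a,b}" "P1 \<inter> P3 = {a,b}" "P2 \<inter> P3 = {a,b}"
    and q: "q \<notin> P1 \<union> P2 \<union> P3"
    and x: "x2 \<in> P2" "x3 \<in> P3"
    and c2: "connected_component (-(P1 \<union> P3)) q x2"
    and c3: "connected_component (-(P1 \<union> P2)) q x3"
    and z: "z \<in> opposite_side (P1 \<union> P2) q" "z \<in> opposite_side (P1 \<union> P3) q"
  for P1 P2 P3 :: "complex set" and x2 x3 z
  proof -
    define D2 where "D2 = opposite_side (P1 \<union> P2) q"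
    define D3 where "D3 = opposite_side (P1 \<union> P3) q"
    have J: "jordan_curve (P1 \<union> P2)" "jordan_curve (P1 \<union> P3)"
      using jordan_curve_join arcs disj by blast+
    have ab: "a \<in> P1" "b \<in> P1" using disj by auto
    have "D2 \<inter> P3 = {}"
    proof -
      have "y \<notin> D2" if "y \<in> P3" for y
      proof (cases "y \<in> {a,b}")
        case False
        then have "connected_component (-(P1 \<union> P2)) y q"
          by (intro open_arc_same_component[OF arcs(3) _ _ x(2) _ c3]) (use disj that in auto)
        then show ?thesis by (auto simp: D2_def opposite_side_def)
      qed (use ab in \<open>auto simp: D2_def opposite_side_def\<close>)
      then show ?thesis by blast
    qed
    then have D2: "D2 \<inter> (P1 \<union> P3) = {}" by (auto simp: D2_def opposite_side_def)
    have "D3 \<inter> P2 = {}"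
    proof -
      have "y \<notin> D3" if "y \<in> P2" for y
      proof (cases "y \<in> {a,b}")
        case False
        then have "connected_component (-(P1 \<union> P3)) y q"
          by (intro open_arc_same_component[OF arcs(2) _ _ x(1) _ c2]) (use disj that in auto)
        then show ?thesis by (auto simp: D3_def opposite_side_def)
      qed (use ab in \<open>auto simp: D3_def opposite_side_def\<close>)
      then show ?thesis by blast
    qed
    then have D3: "D3 \<inter> (P1 \<union> P2) = {}" by (auto simp: D3_def opposite_side_def)
    have "D2 \<subseteq> D3" unfolding D3_def
      by (rule connected_in_opposite_side[OF _ D2 _ z(2)])
        (use z J q in \<open>auto simp: D2_def opposite_side_connected\<close>)
    moreover have "D3 \<subseteq> D2" unfolding D2_def
      by (rule connected_in_opposite_side[OF _ D3 _ z(1)])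
        (use z J q in \<open>auto simp: D3_def opposite_side_connected\<close>)
    ultimately have "frontier D2 = frontier D3" by simp
    then have "P1 \<union> P2 = P1 \<union> P3"
      using opposite_side_frontier[OF J(1), of q] opposite_side_frontier[OF J(2), of q] q
      by (simp add: D2_def D3_def)
    moreover have "x3 \<notin> P1 \<union> P2" using connected_component_in[OF c3] by blast
    ultimately show False using x by blast
  qed
  have J: "jordan_curve (P1 \<union> P2)"
    using jordan_curve_join arcs disj by blast
  obtain z where z: "z \<in> opposite_side (P1 \<union> P2) q" "z \<notin> P3"
  proof -
    have "\<not> opposite_side (P1 \<union> P2) q \<subseteq> P3"
    proof
      assume "opposite_side (P1 \<union> P2) q \<subseteq> P3"
      then have "closure (opposite_side (P1 \<union> P2) q) \<subseteq> P3"
        using arc_between_closed[OF arcs(3)] by (simp add: closure_minimal)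
      then have "P1 \<union> P2 \<subseteq> P3" using opposite_side_frontier[OF J, of q] q by (auto simp: frontier_def)
      then have "x1 \<in> P2 \<union> P3" using x by blast
      then show False using connected_component_in[OF c1] by blast
    qed
    then show thesis using that by blast
  qed
  have sep: "z \<notin> P1 \<union> P2 \<union> P3" "\<not> connected_component (-(P1 \<union> P2)) z q"
    using z by (auto simp: opposite_side_def)
  have "\<not> (connected_component (-(P1 \<union> P3)) z q \<and> connected_component (-(P2 \<union> P3)) z q)"
  proof
    assume as: "connected_component (-(P1 \<union> P3)) z q \<and> connected_component (-(P2 \<union> P3)) z q"
    have "(P1 \<union> P3) \<inter> (P2 \<union> P3) = P3" using disj by blast
    then have "connected ((P1 \<union> P3) \<inter> (P2 \<union> P3))"
      using arc_between_connected[OF arcs(3)] by simp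
    moreover have "compact (P1 \<union> P3)" "closed (P2 \<union> P3)"
      using arcs by (simp_all add: arc_between_compact arc_between_closed compact_Un closed_Un)
    ultimately have "connected_component (-((P1 \<union> P3) \<union> (P2 \<union> P3))) z q"
      using as Janiszewski[of "P1 \<union> P3" "P2 \<union> P3"] by blast
    then have "connected_component (-(P1 \<union> P2)) z q"
      by (rule connected_component_of_subset) blast
    then show False using sep by blast
  qed
  then consider "z \<in> opposite_side (P1 \<union> P3) q" | "z \<in> opposite_side (P2 \<union> P3) q"
    using sep by (auto simp: opposite_side_def)
  then show False
  proof cases
    case 1
    show False by (rule key[OF arcs disj q x(2,3) c2 c3 z(1) 1])
  next
    case 2
    have disj': "P2 \<inter> P1 = {a,b}" using disj by blast
    have q': "q \<notin> P2 \<union> P1 \<union> P3" using q by blast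
    have c3': "connected_component (-(P2 \<union> P1)) q x3" using c3 by (simp add: Un_commute)
    have z': "z \<in> opposite_side (P2 \<union> P1) q" using z by (simp add: Un_commute)
    show False by (rule key[OF arcs(2,1,3) disj' disj(3,2) q' x(1,3) c1 c3' z' 2])
  qed
qed

section \<open>Proper crossings\<close>

lemma proper_crossing_mem:
  assumes "proper_crossing e f x"
  shows "x \<in> e" "x \<in> f"
proof -
  obtain U h h' where U: "open U" "x \<in> U" "homeomorphism U (ball 0 1) h h'" "h x = 0"
    "h ` (e \<inter> U) = {z \<in> ball 0 1. Im z = 0}" "h ` (f \<inter> U) = {z \<in> ball 0 1. Re z = 0}"
    using assms unfolding proper_crossing_def by blast
  have "0 \<in> h ` (e \<inter> U)" "0 \<in> h ` (f \<inter> U)" unfolding U by auto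
  moreover have "inj_on h U" using U(3) unfolding homeomorphism_def by (metis inj_on_inverseI)
  ultimately show "x \<in> e" "x \<in> f" using U(2,4) by (auto simp: inj_on_def)
qed

lemma proper_crossing_commute:
  assumes "proper_crossing e f x"
  shows "proper_crossing f e x"
proof -
  obtain U h h' where U: "open U" "x \<in> U" "homeomorphism U (ball 0 1) h h'" "h x = 0"
    "h ` (e \<inter> U) = {z \<in> ball 0 1. Im z = 0}" "h ` (f \<inter> U) = {z \<in> ball 0 1. Re z = 0}"
    using assms unfolding proper_crossing_def by blast
  have rot: "homeomorphism (ball 0 1) (ball 0 1) (\<lambda>z. \<i> * z) (\<lambda>z. - \<i> * z)"
    by (rule homeomorphismI)
      (auto intro!: continuous_intros simp: norm_mult simp flip: mult.assoc)
  have im: "(\<lambda>z. \<i> * h z) ` X = (\<lambda>z. \<i> * z) ` h ` X" for X by auto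
  have "(\<lambda>z. \<i> * h z) ` (f \<inter> U) = {z \<in> ball 0 1. Im z = 0}"
    unfolding im U(6)
  proof (intro equalityI subsetI)
    fix z :: complex assume "z \<in> {z \<in> ball 0 1. Im z = 0}"
    then show "z \<in> (*) \<i> ` {z \<in> ball 0 1. Re z = 0}"
      by (intro image_eqI[of _ _ "- \<i> * z"]) (auto simp: norm_mult simp flip: mult.assoc)
  qed (auto simp: norm_mult)
  moreover have "(\<lambda>z. \<i> * h z) ` (e \<inter> U) = {z \<in> ball 0 1. Re z = 0}"
    unfolding im U(5)
  proof (intro equalityI subsetI)
    fix z :: complex assume "z \<in> {z \<in> ball 0 1. Re z = 0}"
    then show "z \<in> (*) \<i> ` {z \<in> ball 0 1. Im z = 0}"
      by (intro image_eqI[of _ _ "- \<i> * z"]) (auto simp: norm_mult simp flip: mult.assoc)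
  qed (auto simp: norm_mult)
  moreover have "homeomorphism U (ball 0 1) ((\<lambda>z. \<i> * z) \<circ> h) (h' \<circ> (\<lambda>z. - \<i> * z))"
    by (rule homeomorphism_compose[OF U(3) rot])
  ultimately show ?thesis
    unfolding proper_crossing_def
    by (intro exI[of _ U] exI[of _ "(\<lambda>z. \<i> * z) \<circ> h"] exI[of _ "h' \<circ> (\<lambda>z. - \<i> * z)"])
      (use U in \<open>auto simp: o_def\<close>)
qed

lemma edges_cross_commute: "edges_cross e f \<longleftrightarrow> edges_cross f e"
  unfolding edges_cross_def using proper_crossing_commute by blast

text \<open>
  Membership of a point of \<open>U\<close> in the curves is read off from its image, which spares pulling sets
  back and forth through \<open>h\<close>.
\<close>

definition crossing_chart ::
  "complex set \<Rightarrow> complex set \<Rightarrow> complex \<Rightarrow> complex set \<Rightarrow> (complex \<Rightarrow> complex) \<Rightarrow> (complex \<Rightarrow> complex) \<Rightarrow> bool"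
  where "crossing_chart e f x U h h' \<longleftrightarrow>
    open U \<and> x \<in> U \<and> homeomorphism U (ball 0 1) h h' \<and> h x = 0 \<and>
    (\<forall>p\<in>U. p \<in> e \<longleftrightarrow> Im (h p) = 0) \<and> (\<forall>p\<in>U. p \<in> f \<longleftrightarrow> Re (h p) = 0)"

text \<open>
  Proper crossing is a local notion: restricting a chart to a small disc and rescaling the disc to
  the unit disc gives a chart inside any prescribed neighbourhood.
\<close>

lemma small_crossing_chart:
  assumes "proper_crossing e f x" "open V" "x \<in> V"
  obtains U h h' where "U \<subseteq> V" "crossing_chart e f x U h h'"
proof -
  obtain U h h' where U: "open U" "x \<in> U" and hom: "homeomorphism U (ball 0 1) h h'" and hx: "h x = 0"
    and he: "h ` (e \<inter> U) = {z \<in> ball 0 1. Im z = 0}" and hf: "h ` (f \<inter> U) = {z \<in> ball 0 1. Re z = 0}"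
    using assms unfolding proper_crossing_def by blast
  have inv: "h' (h p) = p" "h p \<in> ball 0 1" if "p \<in> U" for p
    using hom that unfolding homeomorphism_def by auto
  have inv': "h (h' z) = z" "h' z \<in> U" if "z \<in> ball 0 1" for z
    using hom that unfolding homeomorphism_def by auto
  have e: "p \<in> e \<longleftrightarrow> Im (h p) = 0" if "p \<in> U" for p
  proof
    assume "p \<in> e" then show "Im (h p) = 0" using he that by blast
  next
    assume "Im (h p) = 0"
    then have "h p \<in> h ` (e \<inter> U)" using he inv that by auto
    then show "p \<in> e" using inv that by (metis IntD1 IntD2 imageE)
  qed
  have f: "p \<in> f \<longleftrightarrow> Re (h p) = 0" if "p \<in> U" for p
  proof
    assume "p \<in> f" then show "Re (h p) = 0" using hf that by blast
  next
    assume "Re (h p) = 0"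
    then have "h p \<in> h ` (f \<inter> U)" using hf inv that by auto
    then show "p \<in> f" using inv that by (metis IntD1 IntD2 imageE)
  qed
  have conth': "continuous_on (ball 0 1) h'" using hom by (simp add: homeomorphism_def)
  have "open (h' -` V \<inter> ball 0 1)"
    using conth' assms(2) by (metis Int_commute continuous_on_open_vimage open_ball)
  moreover have "0 \<in> h' -` V \<inter> ball 0 1" using inv(1)[OF U(2)] hx assms(3) by auto
  ultimately obtain r where r: "r > 0" "ball 0 r \<subseteq> h' -` V \<inter> ball 0 1"
    using open_contains_ball by blast
  have rb: "ball 0 r \<subseteq> ball (0::complex) 1" "h' ` ball 0 r \<subseteq> V" using r by auto
  define W where "W = h' ` ball 0 r"
  have WU: "W \<subseteq> U" using rb inv' by (auto simp: W_def)
  have hW: "h ` W = ball 0 r" using inv' rb by (force simp: W_def image_image)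
  have hom1: "homeomorphism W (ball 0 r) h h'"
    using hom WU rb(1) hW W_def by (auto simp: homeomorphism_def intro: continuous_on_subset)
  have W: "W = U \<inter> h -` ball 0 r"
  proof
    show "W \<subseteq> U \<inter> h -` ball 0 r" using WU hW by blast
    show "U \<inter> h -` ball 0 r \<subseteq> W" unfolding W_def using inv by force
  qed
  have "continuous_on U h" using hom by (simp add: homeomorphism_def)
  then have "open W" unfolding W using U(1)
    by (simp add: continuous_on_open_vimage Int_commute)
  have scale: "homeomorphism (ball 0 r) (ball 0 1)
    (\<lambda>z. z / complex_of_real r) (\<lambda>z. z * complex_of_real r)"
  proof (rule homeomorphismI)
    show "continuous_on (ball 0 r) (\<lambda>z. z / complex_of_real r)"
      using r(1) by (intro continuous_intros) auto
    show "continuous_on (ball 0 1) (\<lambda>z. z * complex_of_real r)"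
      by (intro continuous_intros)
  qed (use r(1) in \<open>auto simp: norm_mult norm_divide field_simps\<close>)
  show thesis
  proof (rule that[of W])
    show "W \<subseteq> V" using rb W_def by simp
    have "homeomorphism W (ball 0 1) ((\<lambda>z. z / of_real r) \<circ> h) (h' \<circ> (\<lambda>z. z * of_real r))"
      by (rule homeomorphism_compose[OF hom1 scale])
    then show "crossing_chart e f x W ((\<lambda>z. z / of_real r) \<circ> h) (h' \<circ> (\<lambda>z. z * of_real r))"
      unfolding crossing_chart_def using \<open>open W\<close> WU U(2) hx r(1) e f by (auto simp: W)
  qed
qed

text \<open>
  A curve through a crossing that is cut there into two pieces traverses its axis, one piece on each
  half. The half axes are connected, so each of them lies in one piece, and they lie in different
  pieces because the crossing point is a limit point of both. Which half belongs to which piece is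
  recorded by the sign \<open>s\<close>; the coordinate pair \<open>L\<close>, \<open>L'\<close> serves both axes.
\<close>

lemma crossing_chart_halves:
  assumes ch: "homeomorphism U (ball 0 1) h h'" "x \<in> U" "h x = 0"
    and axis: "\<And>p. p \<in> U \<Longrightarrow> p \<in> e1 \<union> e2 \<longleftrightarrow> L' (h p) = 0"
    and L: "(L = Re \<and> L' = Im) \<or> (L = Im \<and> L' = Re)"
    and op: "open U"
    and e: "e1 \<inter> e2 = {x}" "closed e1" "closed e2" "x islimpt e1" "x islimpt e2"
  obtains s :: real where "s = 1 \<or> s = -1"
    "\<And>p. p \<in> U \<Longrightarrow> p \<in> e1 \<longleftrightarrow> L' (h p) = 0 \<and> s * L (h p) \<le> 0"
    "\<And>p. p \<in> U \<Longrightarrow> p \<in> e2 \<longleftrightarrow> L' (h p) = 0 \<and> s * L (h p) \<ge> 0"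
proof -
  note result = that
  have inv: "h' (h p) = p" "h p \<in> ball 0 1" if "p \<in> U" for p
    using ch(1) that unfolding homeomorphism_def by auto
  have inv': "h (h' z) = z" "h' z \<in> U" if "z \<in> ball 0 1" for z
    using ch(1) that unfolding homeomorphism_def by auto
  have conth': "continuous_on (ball 0 1) h'" using ch(1) by (simp add: homeomorphism_def)
  define H where "H t = {p \<in> U. L' (h p) = 0 \<and> t * L (h p) > 0}" for t :: real
  have zero: "p = x" if "p \<in> U" "L' (h p) = 0" "L (h p) = 0" for p
  proof -
    have "h p = 0" using that L by (auto simp: complex_eq_iff)
    then show ?thesis using inv(1)[OF that(1)] inv(1)[OF ch(2)] ch(3) by simp
  qed
  have lin: "L 0 = 0" "L' 0 = 0" using L by auto
  have conv: "convex {z. L' z = 0 \<and> t * L z > 0}" for t :: real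
    using L
    by (auto simp: convex_def algebra_simps)
      (smt (verit) mult_left_le_imp_le mult_nonneg_nonneg mult_pos_pos mult.left_commute mult_minus_right mult.assoc mult.commute)+
  have side: "H t \<subseteq> e1 \<or> H t \<subseteq> e2" for t
  proof -
    have "H t = h' ` (ball 0 1 \<inter> {z. L' z = 0 \<and> t * L z > 0})"
    proof
      show "H t \<subseteq> h' ` (ball 0 1 \<inter> {z. L' z = 0 \<and> t * L z > 0})"
      proof
        fix p assume "p \<in> H t"
        then show "p \<in> h' ` (ball 0 1 \<inter> {z. L' z = 0 \<and> t * L z > 0})"
          using inv[of p] by (intro image_eqI[of _ _ "h p"]) (auto simp: H_def)
      qed
    qed (use inv' in \<open>auto simp: H_def\<close>)
    moreover have "connected (h' ` (ball 0 1 \<inter> {z. L' z = 0 \<and> t * L z > 0}))"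
      by (intro connected_continuous_image continuous_on_subset[OF conth'] convex_connected
          convex_Int conv) auto
    ultimately have con: "connected (H t)" by simp
    have sub: "H t \<subseteq> e1 \<union> e2" using axis by (auto simp: H_def)
    have "x \<notin> H t" using ch lin by (auto simp: H_def)
    then have "e1 \<inter> e2 \<inter> H t = {}" unfolding e(1) by simp
    then have "e1 \<inter> H t = {} \<or> e2 \<inter> H t = {}"
      using connected_closedD[OF con _ sub e(2,3)] by blast
    then show ?thesis using sub by blast
  qed
  have cover: "p \<in> H 1 \<union> H (-1) \<union> {x}" if "p \<in> U" "p \<in> e1 \<union> e2" for p
    using that axis zero[of p] by (cases "L (h p)" "0 :: real" rule: linorder_cases) (auto simp: H_def)
  have nsub: "\<not> H 1 \<union> H (-1) \<subseteq> e1"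
  proof
    assume "H 1 \<union> H (-1) \<subseteq> e1"
    then have "e2 \<inter> U \<subseteq> {x}" using cover e(1) by blast
    moreover obtain y where "y \<in> e2" "y \<in> U" "y \<noteq> x"
      using e(5) op ch(2) by (auto simp: islimpt_def)
    ultimately show False by blast
  qed
  have nsub2: "\<not> H 1 \<union> H (-1) \<subseteq> e2"
  proof
    assume "H 1 \<union> H (-1) \<subseteq> e2"
    then have "e1 \<inter> U \<subseteq> {x}" using cover e(1) by blast
    moreover obtain y where "y \<in> e1" "y \<in> U" "y \<noteq> x"
      using e(4) op ch(2) by (auto simp: islimpt_def)
    ultimately show False by blast
  qed
  have xH: "x \<notin> H t" for t using ch lin by (auto simp: H_def)
  have fin: thesis if s: "s = 1 \<or> s = -1" "H (-s) \<subseteq> e1" "H s \<subseteq> e2" for s :: real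
  proof (rule result)
    show "s = 1 \<or> s = -1" by (rule s(1))
    fix p assume p: "p \<in> U"
    have x: "x \<in> e1" "x \<in> e2" using e(1) by auto
    show "p \<in> e1 \<longleftrightarrow> L' (h p) = 0 \<and> s * L (h p) \<le> 0"
    proof
      assume p1: "p \<in> e1"
      then have "p \<notin> H s" using s(3) e(1) xH[of s] by (metis IntI singletonD subsetD)
      then show "L' (h p) = 0 \<and> s * L (h p) \<le> 0"
        using axis[OF p] p1 p by (auto simp: H_def)
    next
      assume *: "L' (h p) = 0 \<and> s * L (h p) \<le> 0"
      show "p \<in> e1"
      proof (cases "L (h p) = 0")
        case True then show ?thesis using zero p * x by auto
      next
        case False
        then have "p \<in> H (-s)" using * p s(1) by (auto simp: H_def)
        then show ?thesis using s by blast
      qed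
    qed
    show "p \<in> e2 \<longleftrightarrow> L' (h p) = 0 \<and> s * L (h p) \<ge> 0"
    proof
      assume p1: "p \<in> e2"
      then have "p \<notin> H (-s)" using s(2) e(1) xH[of "-s"] by (metis IntI singletonD subsetD)
      then show "L' (h p) = 0 \<and> s * L (h p) \<ge> 0"
        using axis[OF p] p1 p by (auto simp: H_def)
    next
      assume *: "L' (h p) = 0 \<and> s * L (h p) \<ge> 0"
      show "p \<in> e2"
      proof (cases "L (h p) = 0")
        case True then show ?thesis using zero p * x by auto
      next
        case False
        then have "p \<in> H s" using * p s(1) by (auto simp: H_def)
        then show ?thesis using s by blast
      qed
    qed
  qed
  show thesis
    using side[of 1] side[of "-1"] nsub nsub2 fin[of 1] fin[of "-1"] by auto
qed

text \<open>
  Near the crossing, \<open>K\<close> runs at most along the branches \<open>e1\<close> and \<open>f1\<close>. The other two branches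
  bound a quadrant of the chart, and this closed quadrant without the crossing point is convex and
  misses \<open>K\<close>; it connects \<open>e2\<close> with \<open>f2\<close>.
\<close>

lemma crossing_corner:
  assumes x: "proper_crossing (e1 \<union> e2) (f1 \<union> f2) x"
    and arcs: "arc_between e1 a x" "arc_between e2 x a'" "arc_between f1 b x" "arc_between f2 x b'"
    and int: "e1 \<inter> e2 = {x}" "f1 \<inter> f2 = {x}"
    and K: "closed C" "x \<notin> C" "K \<subseteq> e1 \<union> f1 \<union> C"
    and out: "e2 \<inter> K \<subseteq> {x}" "f2 \<inter> K \<subseteq> {x}"
  shows "connected_component (-K) a' b'"
proof -
  obtain U h h' where U: "U \<subseteq> -C" and ch: "crossing_chart (e1 \<union> e2) (f1 \<union> f2) x U h h'"
    using small_crossing_chart[OF x, of "-C"] K by (auto simp: open_Compl)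
  have U': "open U" "x \<in> U" "homeomorphism U (ball 0 1) h h'" "h x = 0"
    "\<And>p. p \<in> U \<Longrightarrow> p \<in> e1 \<union> e2 \<longleftrightarrow> Im (h p) = 0" "\<And>p. p \<in> U \<Longrightarrow> p \<in> f1 \<union> f2 \<longleftrightarrow> Re (h p) = 0"
    using ch unfolding crossing_chart_def by blast+
  note cl = arc_between_closed[OF arcs(1)] arc_between_closed[OF arcs(2)]
    arc_between_closed[OF arcs(3)] arc_between_closed[OF arcs(4)]
  note lp = arc_between_start_limpt[OF arc_between_sym[OF arcs(1)]] arc_between_start_limpt[OF arcs(2)]
    arc_between_start_limpt[OF arc_between_sym[OF arcs(3)]] arc_between_start_limpt[OF arcs(4)]
  obtain s :: real where s: "s = 1 \<or> s = -1"
    "\<And>p. p \<in> U \<Longrightarrow> p \<in> e1 \<longleftrightarrow> Im (h p) = 0 \<and> s * Re (h p) \<le> 0"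
    "\<And>p. p \<in> U \<Longrightarrow> p \<in> e2 \<longleftrightarrow> Im (h p) = 0 \<and> s * Re (h p) \<ge> 0"
    by (rule crossing_chart_halves[OF U'(3,2,4,5) _ U'(1) int(1) cl(1,2) lp(1,2), where L=Re]) auto
  obtain t :: real where t: "t = 1 \<or> t = -1"
    "\<And>p. p \<in> U \<Longrightarrow> p \<in> f1 \<longleftrightarrow> Re (h p) = 0 \<and> t * Im (h p) \<le> 0"
    "\<And>p. p \<in> U \<Longrightarrow> p \<in> f2 \<longleftrightarrow> Re (h p) = 0 \<and> t * Im (h p) \<ge> 0"
    by (rule crossing_chart_halves[OF U'(3,2,4,6) _ U'(1) int(2) cl(3,4) lp(3,4), where L=Im]) auto
  have inv': "h (h' z) = z" "h' z \<in> U" if "z \<in> ball 0 1" for z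
    using U'(3) that unfolding homeomorphism_def by auto
  have conth': "continuous_on (ball 0 1) h'" using U'(3) by (simp add: homeomorphism_def)
  \<comment> \<open>The corner between the branches \<open>e2\<close> and \<open>f2\<close>. The linear form \<open>m\<close> below is positive on it,
    so convex combinations do not reach the excluded origin.\<close>
  define Q where "Q = {z. s * Re z \<ge> 0 \<and> t * Im z \<ge> 0 \<and> z \<noteq> 0}"
  have "convex Q"
  proof (rule convexI)
    fix y z :: complex and u v :: real
    assume yz: "y \<in> Q" "z \<in> Q" and uv: "u \<ge> 0" "v \<ge> 0" "u + v = 1"
    define m where "m w = s * Re w + t * Im w" for w
    have m: "m w > 0" if "w \<in> Q" for w
    proof -
      have "Re w \<noteq> 0 \<or> Im w \<noteq> 0" "s * Re w \<ge> 0" "t * Im w \<ge> 0"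
        using that by (auto simp: Q_def complex_eq_iff)
      then show ?thesis using s(1) t(1) unfolding m_def by (smt (verit) mult_eq_0_iff)
    qed
    have "m (u *\<^sub>R y + v *\<^sub>R z) = u * m y + v * m z" by (simp add: m_def algebra_simps)
    moreover have "u * m y + v * m z > 0"
      using m[OF yz(1)] m[OF yz(2)] uv
      by (metis add_nonneg_pos add_pos_nonneg mult_nonneg_nonneg mult_pos_pos less_eq_real_def add.right_neutral zero_neq_one)
    moreover have "m 0 = 0" by (simp add: m_def)
    ultimately have "u *\<^sub>R y + v *\<^sub>R z \<noteq> 0" by force
    moreover have "s * Re (u *\<^sub>R y + v *\<^sub>R z) = u * (s * Re y) + v * (s * Re z)"
      "t * Im (u *\<^sub>R y + v *\<^sub>R z) = u * (t * Im y) + v * (t * Im z)"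
      by (simp_all add: algebra_simps)
    ultimately show "u *\<^sub>R y + v *\<^sub>R z \<in> Q" using yz uv by (auto simp: Q_def)
  qed
  define W where "W = h' ` (ball 0 1 \<inter> Q)"
  have conW: "connected W" unfolding W_def
    by (intro connected_continuous_image continuous_on_subset[OF conth'] convex_connected
          convex_Int \<open>convex Q\<close>) auto
  have WU: "p \<in> U" "h p \<in> Q" if "p \<in> W" for p using that inv' by (auto simp: W_def)
  have xW: "x \<notin> W" using WU(2)[of x] U'(4) by (auto simp: Q_def)
  have WK: "W \<inter> K = {}"
  proof (rule ccontr)
    assume "W \<inter> K \<noteq> {}"
    then obtain p where p: "p \<in> W" "p \<in> K" by blast
    have "p \<in> e1 \<union> f1" using p K(3) U WU(1)[OF p(1)] by blast
    then have "h p = 0"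
    proof
      assume "p \<in> e1"
      then have "Im (h p) = 0" "s * Re (h p) = 0"
        using s(2)[OF WU(1)[OF p(1)]] WU(2)[OF p(1)] by (auto simp: Q_def)
      then show ?thesis using s(1) by (auto simp: complex_eq_iff)
    next
      assume "p \<in> f1"
      then have "Re (h p) = 0" "t * Im (h p) = 0"
        using t(2)[OF WU(1)[OF p(1)]] WU(2)[OF p(1)] by (auto simp: Q_def)
      then show ?thesis using t(1) by (auto simp: complex_eq_iff)
    qed
    then show False using WU(2)[OF p(1)] by (auto simp: Q_def)
  qed
  obtain y where y: "y \<in> W" "y \<in> e2"
  proof -
    define w where "w = Complex (s/2) 0"
    have w: "w \<in> ball 0 1" "w \<in> Q" using s(1) by (auto simp: w_def Q_def complex_eq_iff complex_norm)
    have "h' w \<in> e2" using s(1) by (simp add: s(3) inv'[OF w(1)]) (auto simp: w_def)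
    then show thesis by (intro that[of "h' w"]) (use w in \<open>auto simp: W_def\<close>)
  qed
  obtain y' where y': "y' \<in> W" "y' \<in> f2"
  proof -
    define w where "w = Complex 0 (t/2)"
    have w: "w \<in> ball 0 1" "w \<in> Q" using t(1) by (auto simp: w_def Q_def complex_eq_iff complex_norm)
    have "h' w \<in> f2" using t(1) by (simp add: t(3) inv'[OF w(1)]) (auto simp: w_def)
    then show thesis by (intro that[of "h' w"]) (use w in \<open>auto simp: W_def\<close>)
  qed
  have con: "connected (e2 - {x})" "connected (f2 - {x})"
    using arcs arc_between_connected_minus_end by blast+
  have "connected ((e2 - {x}) \<union> W \<union> (f2 - {x}))"
    by (intro connected_Un con conW) (use y y' xW in blast)+
  moreover have "(e2 - {x}) \<union> W \<union> (f2 - {x}) \<subseteq> -K" using WK out by blast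
  moreover have "a' \<in> e2 - {x}" "b' \<in> f2 - {x}" using arc_between_ends arcs by blast+
  ultimately show ?thesis unfolding connected_component_def by blast
qed

text \<open>
  The two halves of the chart disc beside \<open>J\<close> contain the two branches of the crossing arc. If these
  were in the same component of the complement of \<open>J\<close>, then the other component would stay away from
  the crossing point, although by the Jordan curve theorem every point of \<open>J\<close> is on its frontier.
\<close>

lemma crossing_separates:
  assumes x: "proper_crossing e (f1 \<union> f2) x"
    and arcs: "arc_between f1 b x" "arc_between f2 x b'"
    and int: "f1 \<inter> f2 = {x}"
    and J: "jordan_curve J" "J = e \<union> C" "closed C" "x \<notin> C"
    and out: "(f1 \<union> f2) \<inter> J = {x}"
  shows "\<not> connected_component (-J) b b'"
proof
  assume cc: "connected_component (-J) b b'"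
  obtain U h h' where U: "U \<subseteq> -C" and ch: "crossing_chart e (f1 \<union> f2) x U h h'"
    using small_crossing_chart[OF x, of "-C"] J(3,4) by (auto simp: open_Compl)
  have U': "open U" "x \<in> U" "homeomorphism U (ball 0 1) h h'" "h x = 0"
    "\<And>p. p \<in> U \<Longrightarrow> p \<in> e \<longleftrightarrow> Im (h p) = 0" "\<And>p. p \<in> U \<Longrightarrow> p \<in> f1 \<union> f2 \<longleftrightarrow> Re (h p) = 0"
    using ch unfolding crossing_chart_def by blast+
  note cl = arc_between_closed[OF arcs(1)] arc_between_closed[OF arcs(2)]
  note lp = arc_between_start_limpt[OF arc_between_sym[OF arcs(1)]] arc_between_start_limpt[OF arcs(2)]
  obtain t :: real where t: "t = 1 \<or> t = -1"
    "\<And>p. p \<in> U \<Longrightarrow> p \<in> f1 \<longleftrightarrow> Re (h p) = 0 \<and> t * Im (h p) \<le> 0"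
    "\<And>p. p \<in> U \<Longrightarrow> p \<in> f2 \<longleftrightarrow> Re (h p) = 0 \<and> t * Im (h p) \<ge> 0"
    by (rule crossing_chart_halves[OF U'(3,2,4,6) _ U'(1) int cl lp, where L=Im]) auto
  have inv': "h (h' z) = z" "h' z \<in> U" if "z \<in> ball 0 1" for z
    using U'(3) that unfolding homeomorphism_def by auto
  have inv: "h' (h p) = p" "h p \<in> ball 0 1" if "p \<in> U" for p
    using U'(3) that unfolding homeomorphism_def by auto
  have conth': "continuous_on (ball 0 1) h'" using U'(3) by (simp add: homeomorphism_def)
  have conv: "convex {z. r * Im z > 0}" for r :: real
  proof -
    have "{z. r * Im z > 0} = {z. inner (of_real r * \<i>) z > 0}" by (auto simp: inner_complex_def)
    then show ?thesis using convex_halfspace_gt[of 0 "of_real r * \<i>"] by simp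
  qed
  define H where "H r = h' ` (ball 0 1 \<inter> {z. r * Im z > 0})" for r
  have conH: "connected (H r)" for r unfolding H_def
    by (intro connected_continuous_image continuous_on_subset[OF conth'] convex_connected
          convex_Int conv) auto
  have HU: "p \<in> U" "r * Im (h p) > 0" if "p \<in> H r" for p r using that inv' by (auto simp: H_def)
  have HJ: "H r \<subseteq> -J" for r
    using HU[of _ r] U'(5) U J(2) by fastforce
  have xJ: "x \<in> J" using out by blast
  have bJ: "b \<notin> J" "b' \<notin> J" using connected_component_in[OF cc] by auto
  define w where "w r = Complex 0 (r/2)" for r
  have w: "w r \<in> ball 0 1" "h' (w r) \<in> H r" if "r = 1 \<or> r = -1" for r
    using that by (auto simp: H_def w_def complex_norm)
  have t': "t = 1 \<or> t = -1" "-t = 1 \<or> -t = -1" using t(1) by auto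
  have wx: "h' (w r) \<noteq> x" if "r = 1 \<or> r = -1" for r
  proof
    assume "h' (w r) = x"
    then have "w r = 0" using inv'(1)[OF w(1)[OF that]] U'(4) by simp
    then show False using that by (auto simp: w_def complex_eq_iff)
  qed
  have "h' (w t) \<in> f2" "h' (w (-t)) \<in> f1"
    using t(1) w(1)[OF t'(1)] w(1)[OF t'(2)] by (simp_all add: t inv') (auto simp: w_def)
  then have fpt: "h' (w t) \<in> H t \<inter> (f2 - {x})" "h' (w (-t)) \<in> H (-t) \<inter> (f1 - {x})"
    using w[OF t'(1)] w[OF t'(2)] wx[OF t'(1)] wx[OF t'(2)] by auto
  have con: "connected (f1 - {x})" "connected (f2 - {x})"
    using arcs arc_between_connected_minus_end arc_between_sym by blast+
  have fJ: "f1 - {x} \<subseteq> -J" "f2 - {x} \<subseteq> -J" using out by blast+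
  have ends: "b \<in> f1 - {x}" "b' \<in> f2 - {x}" using arc_between_ends arcs by blast+
  have near: "connected_component (-J) b p" if "p \<in> U" "p \<notin> J" for p
  proof -
    have "Im (h p) \<noteq> 0" using U'(5) that J(2) by blast
    then consider "t * Im (h p) > 0" | "-t * Im (h p) > 0"
      using t(1) by (cases "Im (h p)" "0 :: real" rule: linorder_cases) auto
    then show ?thesis
    proof cases
      case 1
      then have "p \<in> H t" using inv[OF that(1)] unfolding H_def by (metis IntI image_eqI mem_Collect_eq)
      moreover have "connected (H t \<union> (f2 - {x}))" using fpt by (intro connected_Un conH con) blast
      ultimately have "connected_component (-J) b' p"
        unfolding connected_component_def using HJ[of t] fJ ends
        by (intro exI[of _ "H t \<union> (f2 - {x})"]) auto
      then show ?thesis using cc connected_component_trans by metis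
    next
      case 2
      then have "p \<in> H (-t)" using inv[OF that(1)] unfolding H_def by (metis IntI image_eqI mem_Collect_eq)
      moreover have "connected (H (-t) \<union> (f1 - {x}))" using fpt by (intro connected_Un conH con) blast
      ultimately show ?thesis
        unfolding connected_component_def using HJ[of "-t"] fJ ends
        by (intro exI[of _ "H (-t) \<union> (f1 - {x})"]) auto
    qed
  qed
  have "x \<in> closure (opposite_side J b)"
    using opposite_side_frontier[OF J(1) bJ(1)] xJ by (auto simp: frontier_def)
  then obtain p where "p \<in> opposite_side J b" "p \<in> U"
    using U'(1,2) by (meson closure_iff_nhds_not_empty disjoint_iff open_Int_closure_eq_empty)
  then show False using near connected_component_sym by (fastforce simp: opposite_side_def)
qed

text \<open>
  Near one of its endpoints an arc minus that endpoint is connected, whereas an axis of the chart minus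
  the origin has points on both sides.
\<close>

lemma no_proper_crossing_at_end:
  assumes "arc_between e x b"
  shows "\<not> proper_crossing e f x"
proof
  assume pc: "proper_crossing e f x"
  obtain U h h' where ch: "crossing_chart e f x U h h'"
    using small_crossing_chart[OF pc, of UNIV] by auto
  have U: "open U" "x \<in> U" "homeomorphism U (ball 0 1) h h'" "h x = 0"
    "\<And>p. p \<in> U \<Longrightarrow> p \<in> e \<longleftrightarrow> Im (h p) = 0"
    using ch unfolding crossing_chart_def by blast+
  have inv': "h (h' z) = z" "h' z \<in> U" if "z \<in> ball 0 1" for z
    using U(3) that unfolding homeomorphism_def by auto
  have inv: "h' (h p) = p" "h p \<in> ball 0 1" if "p \<in> U" for p
    using U(3) that unfolding homeomorphism_def by auto
  have conth: "continuous_on U h" and conth': "continuous_on (ball 0 1) h'"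
    using U(3) by (simp_all add: homeomorphism_def)
  \<comment> \<open>Cut off an initial piece \<open>e1\<close> inside the chart; the rest \<open>e2\<close> stays away from \<open>x\<close>.\<close>
  obtain e1 e2 c where e12: "arc_between e1 x c" "closed e2" "e = e1 \<union> e2" "x \<notin> e2" "e1 \<subseteq> U"
  proof -
    obtain g where g: "arc g" "path_image g = e" "pathstart g = x" "pathfinish g = b"
      using assms by (auto simp: arc_between_def)
    have cont: "continuous_on {0..1} g" using g by (auto simp: arc_def path_def)
    have "g 0 = x" using g by (simp add: pathstart_def)
    then obtain d where d: "d > 0" "\<And>t. t \<in> {0..1} \<Longrightarrow> dist t 0 < d \<Longrightarrow> g t \<in> U"
      using cont U(1,2) unfolding continuous_on_topological open_dist
      by (metis (no_types, lifting) atLeastAtMost_iff dist_commute order_refl zero_le_one)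
    define t where "t = min (d/2) (1/2)"
    have t: "0 < t" "t < 1" "t < d" using d by (auto simp: t_def)
    have ends: "g 0 = x" "g 1 = b" using g by (auto simp: pathstart_def pathfinish_def)
    have inj: "inj_on g {0..1}" using g by (auto simp: arc_def)
    have "arc_between (g ` {0..t}) x (g t)" unfolding arc_between_def
      using arc_subpath_arc[OF g(1), of 0 t] t ends
      by (intro exI[of _ "subpath 0 t g"]) (simp add: path_image_subpath)
    moreover have "closed (g ` {t..1})"
      by (intro compact_imp_closed compact_continuous_image continuous_on_subset[OF cont]) (use t in auto)
    moreover have "{0..1} = {0..t} \<union> {t..1}" using t by auto
    then have "e = g ` {0..t} \<union> g ` {t..1}"
      using g(2) by (simp add: path_image_def image_Un)
    moreover have "x \<notin> g ` {t..1}"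
      using inj t ends by (auto simp: inj_on_def image_iff) fastforce
    moreover have "g ` {0..t} \<subseteq> U" using d t by auto
    ultimately show thesis by (rule that)
  qed
  have con: "connected ((\<lambda>p. Re (h p)) ` (e1 - {x}))"
    by (intro connected_continuous_image arc_between_connected_minus_end[OF e12(1)] continuous_intros
        continuous_on_subset[OF conth]) (use e12 in auto)
  have "0 \<notin> (\<lambda>p. Re (h p)) ` (e1 - {x})"
  proof
    assume "0 \<in> (\<lambda>p. Re (h p)) ` (e1 - {x})"
    then obtain p where "p \<in> e1 - {x}" "0 = Re (h p)" by (rule imageE)
    then have p: "p \<in> e1" "p \<noteq> x" "Re (h p) = 0" by auto
    then have "p \<in> U" "p \<in> e" using e12 by auto
    then have "h p = 0" using U(5)[of p] p by (auto simp: complex_eq_iff)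
    then show False using inv(1)[OF \<open>p \<in> U\<close>] inv(1)[OF U(2)] U(4) p(2) by simp
  qed
  then obtain s :: real where s: "s = 1 \<or> s = -1" "\<And>p. p \<in> e1 - {x} \<Longrightarrow> s * Re (h p) > 0"
  proof -
    assume z: "0 \<notin> (\<lambda>p. Re (h p)) ` (e1 - {x})"
    have "(\<forall>p\<in>e1 - {x}. Re (h p) > 0) \<or> (\<forall>p\<in>e1 - {x}. Re (h p) < 0)"
    proof (rule ccontr)
      assume "\<not> ?thesis"
      then obtain p q where "p \<in> e1 - {x}" "Re (h p) \<le> 0" "q \<in> e1 - {x}" "Re (h q) \<ge> 0"
        by (meson not_le)
      then have "0 \<in> (\<lambda>p. Re (h p)) ` (e1 - {x})"
        using connectedD_interval[OF con, of "Re (h p)" "Re (h q)" 0] by blast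
      then show False using z by simp
    qed
    then show thesis
    proof
      assume "\<forall>p\<in>e1 - {x}. Re (h p) > 0"
      then show thesis by (intro that[of 1]) auto
    next
      assume "\<forall>p\<in>e1 - {x}. Re (h p) < 0"
      then show thesis by (intro that[of "-1"]) auto
    qed
  qed
  have "open (h' -` (-e2) \<inter> ball 0 1)"
    using conth' e12(2) by (metis Int_commute continuous_on_open_vimage open_ball open_Compl)
  moreover have "0 \<in> h' -` (-e2) \<inter> ball 0 1" using inv(1)[OF U(2)] U(4) e12(4) by auto
  ultimately obtain r where r: "r > 0" "ball 0 r \<subseteq> h' -` (-e2) \<inter> ball 0 1"
    using open_contains_ball by blast
  \<comment> \<open>A point of the axis close to \<open>x\<close>, on the half that \<open>e1\<close> does not use.\<close>
  define z where "z = complex_of_real (- s * r / 2)"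
  have z: "z \<in> ball 0 r" "Im z = 0" "s * Re z < 0"
    using s(1) r(1) by (auto simp: z_def norm_mult)
  then have zb: "z \<in> ball 0 1" and ze: "h' z \<notin> e2" using r by auto
  have "h' z \<in> e" using U(5) inv'[OF zb] z by simp
  moreover have "h' z \<noteq> x" using inv'(1)[OF zb] U(4) z by force
  ultimately have "h' z \<in> e1 - {x}" using ze e12(3) by auto
  then show False using s(2) inv'[OF zb] z by force
qed

section \<open>Crossing patterns that simple drawings exclude\<close>

lemma proper_crossing_interior:
  assumes "proper_crossing e f x" "arc_between e a b" "arc_between f c d"
  shows "x \<noteq> a" "x \<noteq> b" "x \<noteq> c" "x \<noteq> d"
  using no_proper_crossing_at_end[OF assms(2)] no_proper_crossing_at_end[OF arc_between_sym[OF assms(2)]]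
    no_proper_crossing_at_end[OF assms(3)] no_proper_crossing_at_end[OF arc_between_sym[OF assms(3)]]
    assms(1) proper_crossing_commute[OF assms(1)] by auto

lemma arc_end_notin_other_piece:
  assumes "arc_between e a x" "arc_between f x c" "e \<inter> f = {x}"
  shows "a \<notin> f" "c \<notin> e"
  using assms arc_between_ends[OF assms(1)] arc_between_ends[OF assms(2)] by (metis IntI singletonD)+

lemma Int_sub_singleton:
  assumes "A \<inter> B = {x}" "A' \<subseteq> A" "B' \<subseteq> B" "x \<in> A'" "x \<in> B'"
  shows "A' \<inter> B' = {x}"
  using assms by auto

lemma Int_sub_empty:
  assumes "A \<inter> B = {x}" "A' \<subseteq> A" "B' \<subseteq> B" "x \<notin> A' \<or> x \<notin> B'"
  shows "A' \<inter> B' = {}"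
  using assms by auto

lemma Int_sub_le:
  assumes "A \<inter> B = {x}" "A' \<subseteq> A" "B' \<subseteq> B"
  shows "A' \<inter> B' \<subseteq> {x}"
  using assms by auto

lemma Un_Int_Un_doubleton:
  assumes "A \<inter> B = {a}" "A' \<inter> B' = {a'}" "A \<inter> B' = {}" "B \<inter> A' = {}"
  shows "(A \<union> A') \<inter> (B \<union> B') = {a, a'}"
  using assms by auto

text \<open>
  Let \<open>J\<close> consist of the edge \<open>p\<close>, the part of \<open>p'\<close> from \<open>b\<close> to the crossing \<open>y\<close>, and the
  part of \<open>l\<close> from \<open>y\<close> back to \<open>a\<close>. The edge \<open>m\<close> crosses this Jordan curve exactly once, at
  \<open>x\<close>, so its endpoints \<open>a'\<close> and \<open>b'\<close> are on different sides. But the remaining parts of \<open>p'\<close> and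
  \<open>l\<close> lead from \<open>a'\<close> and \<open>b'\<close> to the corner of \<open>J\<close> at \<open>y\<close> from the same side.
\<close>

lemma no_thrackle_C4:
  assumes arcs: "arc_between p a b" "arc_between p' a' b" "arc_between l a b'" "arc_between m a' b'"
    and adj: "p \<inter> p' = {b}" "l \<inter> m = {b'}" "p \<inter> l = {a}" "p' \<inter> m = {a'}"
    and x: "p \<inter> m = {x}" "proper_crossing p m x"
    and y: "p' \<inter> l = {y}" "proper_crossing p' l y"
  shows False
proof -
  have xn: "x \<noteq> a" "x \<noteq> b" "x \<noteq> a'" "x \<noteq> b'"
    using proper_crossing_interior[OF x(2) arcs(1,4)] by auto
  have yn: "y \<noteq> a" "y \<noteq> b" "y \<noteq> a'" "y \<noteq> b'"
    using proper_crossing_interior[OF y(2) arcs(2,3)] by auto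
  have mem: "x \<in> p" "x \<in> m" "y \<in> p'" "y \<in> l" using x(1) y(1) by auto
  obtain m1 m2 where m: "arc_between m1 a' x" "arc_between m2 x b'" "m = m1 \<union> m2" "m1 \<inter> m2 = {x}"
    using arc_between_split[OF arcs(4) mem(2)] xn by metis
  obtain p1 p2 where p: "arc_between p1 b y" "arc_between p2 y a'" "p' = p1 \<union> p2" "p1 \<inter> p2 = {y}"
    using arc_between_split[OF arc_between_sym[OF arcs(2)] mem(3)] yn by metis
  obtain l1 l2 where l: "arc_between l1 a y" "arc_between l2 y b'" "l = l1 \<union> l2" "l1 \<inter> l2 = {y}"
    using arc_between_split[OF arcs(3) mem(4)] yn by metis
  have ends: "b \<in> p1" "a' \<in> p2" "y \<in> p1" "y \<in> l1" "a \<in> l1" "b' \<in> l2" "a \<in> p" "b \<in> p"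
    using p(1,2)[THEN arc_between_ends(1)] p(1,2)[THEN arc_between_ends(2)]
      l(1,2)[THEN arc_between_ends(1)] l(1,2)[THEN arc_between_ends(2)]
      arcs(1)[THEN arc_between_ends(1)] arcs(1)[THEN arc_between_ends(2)] by simp_all
  have nin: "a' \<notin> p1" "b \<notin> p2" "b' \<notin> l1" "a \<notin> l2"
    using arc_end_notin_other_piece[OF p(1,2,4)] arc_end_notin_other_piece[OF l(1,2,4)] by simp_all
  have sub: "p1 \<subseteq> p'" "p2 \<subseteq> p'" "l1 \<subseteq> l" "l2 \<subseteq> l" using p l by auto
  define J where "J = p \<union> (p1 \<union> l1)"
  have yp: "y \<notin> p" using adj(1) mem yn by (metis IntI singletonD)
  have pp1: "p \<inter> p1 = {b}" by (rule Int_sub_singleton[OF adj(1) order_refl sub(1) ends(8,1)])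
  have "arc_between (p \<union> p1) a y" by (rule arc_between_join[OF arcs(1) p(1) pp1])
  moreover have "(p \<union> p1) \<inter> l1 = {a, y}"
    using Int_sub_singleton[OF adj(3) order_refl sub(3) ends(7,5)]
      Int_sub_singleton[OF y(1) sub(1,3) ends(3,4)] by (simp add: Int_Un_distrib2 insert_commute)
  ultimately have "jordan_curve ((p \<union> p1) \<union> l1)" using jordan_curve_join l(1) by blast
  then have J: "jordan_curve J" by (simp add: J_def Un_assoc)
  have cl: "closed (p1 \<union> l1)" "closed p"
    using arc_between_closed[OF p(1)] arc_between_closed[OF l(1)] arc_between_closed[OF arcs(1)]
    by (simp_all add: closed_Un)
  have xC: "x \<notin> p1 \<union> l1"
    using adj(1,3) mem sub xn by (metis IntI UnE singletonD subsetD)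
  have "m \<inter> J = {x}"
  proof -
    have "p1 \<inter> m = {}" by (rule Int_sub_empty[OF adj(4) sub(1) order_refl]) (simp add: nin)
    moreover have "l1 \<inter> m = {}" by (rule Int_sub_empty[OF adj(2) sub(3) order_refl]) (simp add: nin)
    ultimately show ?thesis using x(1) unfolding J_def by (simp add: Int_Un_distrib Int_commute)
  qed
  then have "\<not> connected_component (-J) a' b'"
    using crossing_separates[OF _ m(1,2,4) J J_def cl(1) xC] x(2) m(3) by simp
  moreover have "connected_component (-J) a' b'"
  proof (rule crossing_corner)
    show "proper_crossing (p1 \<union> p2) (l1 \<union> l2) y" using y p l by simp
    show "p2 \<inter> J \<subseteq> {y}"
    proof -
      have "p \<inter> p2 = {}" by (rule Int_sub_empty[OF adj(1) order_refl sub(2)]) (simp add: nin)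
      then show ?thesis using Int_sub_le[OF y(1) sub(2,3)] p(4) unfolding J_def by blast
    qed
    show "l2 \<inter> J \<subseteq> {y}"
    proof -
      have "p \<inter> l2 = {}" by (rule Int_sub_empty[OF adj(3) order_refl sub(4)]) (simp add: nin)
      then show ?thesis using Int_sub_le[OF y(1) sub(1,4)] l(4) unfolding J_def by blast
    qed
  qed (use p l cl(2) yp in \<open>auto simp: J_def\<close>)
  ultimately show False by blast
qed

lemma same_component_via_arc:
  assumes "arc_between e u v" "e \<inter> K = {}"
  shows "connected_component (-K) u v"
  unfolding connected_component_def
  using arc_between_connected[OF assms(1)] arc_between_ends[OF assms(1)] assms(2) by blast

text \<open>
  The paths from \<open>a\<close> to \<open>a'\<close> through \<open>b1\<close>, \<open>b2\<close> and \<open>b3\<close> form a theta curve, and the third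
  vertex \<open>q\<close> would reach all of its arcs.
\<close>

lemma no_plane_K33:
  assumes arcs: "arc_between p1 a b1" "arc_between p2 a b2" "arc_between p3 a b3"
      "arc_between p1' a' b1" "arc_between p2' a' b2" "arc_between p3' a' b3"
      "arc_between r1 q b1" "arc_between r2 q b2" "arc_between r3 q b3"
    and star: "p1 \<inter> p2 = {a}" "p1 \<inter> p3 = {a}" "p2 \<inter> p3 = {a}"
      "p1' \<inter> p2' = {a'}" "p1' \<inter> p3' = {a'}" "p2' \<inter> p3' = {a'}"
    and meet: "p1 \<inter> p1' = {b1}" "p2 \<inter> p2' = {b2}" "p3 \<inter> p3' = {b3}"
    and disj: "p1 \<inter> p2' = {}" "p1 \<inter> p3' = {}" "p2 \<inter> p1' = {}" "p2 \<inter> p3' = {}"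
      "p3 \<inter> p1' = {}" "p3 \<inter> p2' = {}"
    and r: "r1 \<inter> (p2 \<union> p2') = {}" "r1 \<inter> (p3 \<union> p3') = {}" "r2 \<inter> (p1 \<union> p1') = {}"
      "r2 \<inter> (p3 \<union> p3') = {}" "r3 \<inter> (p1 \<union> p1') = {}" "r3 \<inter> (p2 \<union> p2') = {}"
  shows False
proof (rule theta_curve_separates)
  show "arc_between (p1 \<union> p1') a a'" "arc_between (p2 \<union> p2') a a'" "arc_between (p3 \<union> p3') a a'"
    using arc_between_join[OF arcs(1) arc_between_sym[OF arcs(4)] meet(1)]
      arc_between_join[OF arcs(2) arc_between_sym[OF arcs(5)] meet(2)]
      arc_between_join[OF arcs(3) arc_between_sym[OF arcs(6)] meet(3)] by simp_all
  have ends: "a \<in> p1" "a \<in> p2" "a \<in> p3" "a' \<in> p1'" "a' \<in> p2'" "a' \<in> p3'"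
    "q \<in> r1" "q \<in> r2" "q \<in> r3" "b1 \<in> p1" "b2 \<in> p2" "b3 \<in> p3"
    using arcs[THEN arc_between_ends(1)] arcs[THEN arc_between_ends(2)] by simp_all
  show "(p1 \<union> p1') \<inter> (p2 \<union> p2') = {a, a'}"
    by (rule Un_Int_Un_doubleton[OF star(1,4) disj(1,3)])
  show "(p1 \<union> p1') \<inter> (p3 \<union> p3') = {a, a'}"
    by (rule Un_Int_Un_doubleton[OF star(2,5) disj(2,5)])
  show "(p2 \<union> p2') \<inter> (p3 \<union> p3') = {a, a'}"
    by (rule Un_Int_Un_doubleton[OF star(3,6) disj(4,6)])
  show "q \<notin> (p1 \<union> p1') \<union> (p2 \<union> p2') \<union> (p3 \<union> p3')" using r ends by blast
  show "b1 \<in> p1 \<union> p1'" "b2 \<in> p2 \<union> p2'" "b3 \<in> p3 \<union> p3'" using ends by auto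
  show "connected_component (-((p2 \<union> p2') \<union> (p3 \<union> p3'))) q b1"
    by (rule same_component_via_arc[OF arcs(7)]) (use r in blast)
  show "connected_component (-((p1 \<union> p1') \<union> (p3 \<union> p3'))) q b2"
    by (rule same_component_via_arc[OF arcs(8)]) (use r in blast)
  show "connected_component (-((p1 \<union> p1') \<union> (p2 \<union> p2'))) q b3"
    by (rule same_component_via_arc[OF arcs(9)]) (use r in blast)
qed

text \<open>
  Follow each leg of the star at \<open>b\<close> to its crossing and from there the crossed leg of the star at
  \<open>b'\<close> back to \<open>b'\<close>: this gives a theta curve from \<open>b\<close> to \<open>b'\<close>. The outer parts of the legs
  lead from the crossings to the leaves without meeting it, \<open>a1\<close> being reached from \<open>z\<close> and \<open>x\<close>,
  and \<open>a2\<close> from \<open>x\<close> and \<open>y\<close>. At the crossing \<open>x\<close> the outer parts leave into a common corner, so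
  \<open>a1\<close> and \<open>a2\<close> are in the same face. That face touches all three arcs, which is impossible.
\<close>

lemma no_cyclic_tripods:
  assumes arcs: "arc_between p1 b a1" "arc_between p2 b a2" "arc_between p3 b a3"
      "arc_between r1 b' a1" "arc_between r2 b' a2" "arc_between r3 b' a3"
    and star: "p1 \<inter> p2 = {b}" "p1 \<inter> p3 = {b}" "p2 \<inter> p3 = {b}"
      "r1 \<inter> r2 = {b'}" "r1 \<inter> r3 = {b'}" "r2 \<inter> r3 = {b'}"
    and meet: "p1 \<inter> r1 = {a1}" "p2 \<inter> r2 = {a2}" "p3 \<inter> r3 = {a3}"
    and cross: "p1 \<inter> r2 = {x}" "p2 \<inter> r3 = {y}" "p3 \<inter> r1 = {z}"
      "proper_crossing p1 r2 x" "proper_crossing p2 r3 y" "proper_crossing p3 r1 z"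
    and disj: "p2 \<inter> r1 = {}" "p3 \<inter> r2 = {}" "p1 \<inter> r3 = {}"
  shows False
proof -
  have xn: "x \<noteq> b" "x \<noteq> b'" "x \<noteq> a1" "x \<noteq> a2"
    using proper_crossing_interior[OF cross(4) arcs(1,5)] by auto
  have yn: "y \<noteq> b" "y \<noteq> b'" "y \<noteq> a2" "y \<noteq> a3"
    using proper_crossing_interior[OF cross(5) arcs(2,6)] by auto
  have zn: "z \<noteq> b" "z \<noteq> b'" "z \<noteq> a3" "z \<noteq> a1"
    using proper_crossing_interior[OF cross(6) arcs(3,4)] by auto
  have mem: "x \<in> p1" "x \<in> r2" "y \<in> p2" "y \<in> r3" "z \<in> p3" "z \<in> r1" using cross by auto
  obtain s1 t1 where p1: "arc_between s1 b x" "arc_between t1 x a1" "p1 = s1 \<union> t1" "s1 \<inter> t1 = {x}"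
    using arc_between_split[OF arcs(1) mem(1)] xn by metis
  obtain s2 t2 where p2: "arc_between s2 b y" "arc_between t2 y a2" "p2 = s2 \<union> t2" "s2 \<inter> t2 = {y}"
    using arc_between_split[OF arcs(2) mem(3)] yn by metis
  obtain s3 t3 where p3: "arc_between s3 b z" "arc_between t3 z a3" "p3 = s3 \<union> t3" "s3 \<inter> t3 = {z}"
    using arc_between_split[OF arcs(3) mem(5)] zn by metis
  obtain u1 v1 where r1: "arc_between u1 b' z" "arc_between v1 z a1" "r1 = u1 \<union> v1" "u1 \<inter> v1 = {z}"
    using arc_between_split[OF arcs(4) mem(6)] zn by metis
  obtain u2 v2 where r2: "arc_between u2 b' x" "arc_between v2 x a2" "r2 = u2 \<union> v2" "u2 \<inter> v2 = {x}"
    using arc_between_split[OF arcs(5) mem(2)] xn by metis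
  obtain u3 v3 where r3: "arc_between u3 b' y" "arc_between v3 y a3" "r3 = u3 \<union> v3" "u3 \<inter> v3 = {y}"
    using arc_between_split[OF arcs(6) mem(4)] yn by metis
  have ends: "b \<in> s1" "b \<in> s2" "b \<in> s3" "b' \<in> u1" "b' \<in> u2" "b' \<in> u3"
    "x \<in> s1" "x \<in> u2" "y \<in> s2" "y \<in> u3" "z \<in> s3" "z \<in> u1"
    "a1 \<in> t1" "a2 \<in> t2" "a3 \<in> t3" "a1 \<in> v1" "a2 \<in> v2" "a3 \<in> v3"
    using p1(1,2)[THEN arc_between_ends(1)] p1(1,2)[THEN arc_between_ends(2)]
      p2(1,2)[THEN arc_between_ends(1)] p2(1,2)[THEN arc_between_ends(2)]
      p3(1,2)[THEN arc_between_ends(1)] p3(1,2)[THEN arc_between_ends(2)]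
      r1(1,2)[THEN arc_between_ends(1)] r1(1,2)[THEN arc_between_ends(2)]
      r2(1,2)[THEN arc_between_ends(1)] r2(1,2)[THEN arc_between_ends(2)]
      r3(1,2)[THEN arc_between_ends(1)] r3(1,2)[THEN arc_between_ends(2)] by simp_all
  have sub: "s1 \<subseteq> p1" "t1 \<subseteq> p1" "s2 \<subseteq> p2" "t2 \<subseteq> p2" "s3 \<subseteq> p3" "t3 \<subseteq> p3"
    "u1 \<subseteq> r1" "v1 \<subseteq> r1" "u2 \<subseteq> r2" "v2 \<subseteq> r2" "u3 \<subseteq> r3" "v3 \<subseteq> r3"
    using p1(3) p2(3) p3(3) r1(3) r2(3) r3(3) by auto
  have nin: "b \<notin> t1" "a1 \<notin> s1" "b \<notin> t2" "a2 \<notin> s2" "b \<notin> t3" "a3 \<notin> s3"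
    "b' \<notin> v1" "a1 \<notin> u1" "b' \<notin> v2" "a2 \<notin> u2" "b' \<notin> v3" "a3 \<notin> u3"
    using arc_end_notin_other_piece[OF p1(1,2,4)] arc_end_notin_other_piece[OF p2(1,2,4)]
      arc_end_notin_other_piece[OF p3(1,2,4)] arc_end_notin_other_piece[OF r1(1,2,4)]
      arc_end_notin_other_piece[OF r2(1,2,4)] arc_end_notin_other_piece[OF r3(1,2,4)] by simp_all
  define Q1 where "Q1 = s1 \<union> u2"
  define Q2 where "Q2 = s2 \<union> u3"
  define Q3 where "Q3 = s3 \<union> u1"
  have su: "s1 \<inter> u2 = {x}" "s2 \<inter> u3 = {y}" "s3 \<inter> u1 = {z}"
    by (rule Int_sub_singleton[OF cross(1)] Int_sub_singleton[OF cross(2)] Int_sub_singleton[OF cross(3)];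
        simp add: sub ends)+
  have Q: "arc_between Q1 b b'" "arc_between Q2 b b'" "arc_between Q3 b b'"
    unfolding Q1_def Q2_def Q3_def
    using arc_between_join[OF p1(1) arc_between_sym[OF r2(1)] su(1)]
      arc_between_join[OF p2(1) arc_between_sym[OF r3(1)] su(2)]
      arc_between_join[OF p3(1) arc_between_sym[OF r1(1)] su(3)] by simp_all
  have su0: "s1 \<inter> u3 = {}" "s2 \<inter> u1 = {}" "s3 \<inter> u2 = {}" using disj sub by blast+
  have su1: "s1 \<inter> u1 = {}" "s2 \<inter> u2 = {}" "s3 \<inter> u3 = {}"
    by (rule meet[THEN Int_sub_empty]; simp add: sub nin)+
  have ss: "s1 \<inter> s2 = {b}" "s1 \<inter> s3 = {b}" "s2 \<inter> s3 = {b}"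
    and uu: "u1 \<inter> u2 = {b'}" "u1 \<inter> u3 = {b'}" "u2 \<inter> u3 = {b'}"
    by (rule star[THEN Int_sub_singleton]; simp add: sub ends)+
  have QQ: "Q1 \<inter> Q2 = {b, b'}" "Q1 \<inter> Q3 = {b, b'}" "Q2 \<inter> Q3 = {b, b'}"
    unfolding Q1_def Q2_def Q3_def
    using Un_Int_Un_doubleton[OF ss(1) uu(3) su0(1) su1(2)]
      Un_Int_Un_doubleton[OF ss(2) uu(1)[unfolded Int_commute[of u1]] su1(1) su0(3)]
      Un_Int_Un_doubleton[OF ss(3) uu(2)[unfolded Int_commute[of u1]] su0(2) su1(3)] by simp_all
  have xQ: "x \<notin> Q2 \<union> Q3" using QQ(1,2) xn ends(7) unfolding Q1_def by (metis IntI UnCI UnE empty_iff insert_iff)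
  have yQ: "y \<notin> Q1 \<union> Q3" using QQ(1,3) yn ends(9) unfolding Q2_def by (metis IntI UnCI UnE empty_iff insert_iff)
  have zQ: "z \<notin> Q1 \<union> Q2" using QQ(2,3) zn ends(11) unfolding Q3_def by (metis IntI UnCI UnE empty_iff insert_iff)
  define K where "K = Q1 \<union> Q2 \<union> Q3"
  have ts: "t1 \<inter> s2 = {}" "t1 \<inter> s3 = {}" "s1 \<inter> t2 = {}" "t2 \<inter> s3 = {}" "s1 \<inter> t3 = {}" "s2 \<inter> t3 = {}"
    and vu: "v1 \<inter> u2 = {}" "v1 \<inter> u3 = {}" "u1 \<inter> v2 = {}" "v2 \<inter> u3 = {}" "u1 \<inter> v3 = {}" "u2 \<inter> v3 = {}"
    by (rule star[THEN Int_sub_empty]; simp add: sub nin)+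
  have tu: "t1 \<inter> u1 = {}" "t2 \<inter> u2 = {}" "t3 \<inter> u3 = {}" "s1 \<inter> v1 = {}" "s2 \<inter> v2 = {}" "s3 \<inter> v3 = {}"
    by (rule meet[THEN Int_sub_empty]; simp add: sub nin)+
  have tu': "t1 \<inter> u2 \<subseteq> {x}" "t2 \<inter> u3 \<subseteq> {y}" "t3 \<inter> u1 \<subseteq> {z}"
    "s1 \<inter> v2 \<subseteq> {x}" "s2 \<inter> v3 \<subseteq> {y}" "s3 \<inter> v1 \<subseteq> {z}"
    by (rule cross(1-3)[THEN Int_sub_le]; simp add: sub)+
  have tu0: "t1 \<inter> u3 = {}" "t2 \<inter> u1 = {}" "t3 \<inter> u2 = {}" "s1 \<inter> v3 = {}" "s2 \<inter> v1 = {}" "s3 \<inter> v2 = {}"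
    using disj sub by blast+
  have tK: "t1 \<inter> K \<subseteq> {x}" "t2 \<inter> K \<subseteq> {y}" "t3 \<inter> K \<subseteq> {z}"
    and vK: "v2 \<inter> K \<subseteq> {x}" "v3 \<inter> K \<subseteq> {y}" "v1 \<inter> K \<subseteq> {z}"
    unfolding K_def Q1_def Q2_def Q3_def
    using ts vu tu tu' tu0 p1(4) p2(4) p3(4) r1(4) r2(4) r3(4)
    by (simp_all add: Int_Un_distrib Int_commute)
  have clQ: "closed (Q2 \<union> Q3)" "closed (Q1 \<union> Q3)" "closed (Q1 \<union> Q2)"
    using Q[THEN arc_between_closed] by (simp_all add: closed_Un)
  have pc: "proper_crossing (s1 \<union> t1) (u2 \<union> v2) x" "proper_crossing (s2 \<union> t2) (u3 \<union> v3) y"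
    using cross(4,5) p1(3) p2(3) r2(3) r3(3) by simp_all
  have c12: "connected_component (-K) a1 a2"
    by (rule crossing_corner[OF pc(1) p1(1,2) r2(1,2) p1(4) r2(4) clQ(1) xQ _ tK(1) vK(1)])
      (auto simp: K_def Q1_def)
  have outer: "connected_component (-(K1 \<union> K2)) u w"
    if "arc_between e w u" "e \<inter> K \<subseteq> {w}" "w \<notin> K1 \<union> K2" "K1 \<subseteq> K" "K2 \<subseteq> K" for e u w K1 K2
    by (rule same_component_via_arc[OF arc_between_sym[OF that(1)]]) (use that in blast)
  show False
  proof (rule theta_curve_separates[OF Q QQ, of a1 x y z])
    show "a1 \<notin> Q1 \<union> Q2 \<union> Q3" using connected_component_in[OF c12] K_def by blast
    show "x \<in> Q1" "y \<in> Q2" "z \<in> Q3" using ends by (auto simp: Q1_def Q2_def Q3_def)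
    show "connected_component (- (Q2 \<union> Q3)) a1 x"
      by (rule outer[OF p1(2) tK(1) xQ]) (auto simp: K_def)
    show "connected_component (- (Q1 \<union> Q2)) a1 z"
      by (rule outer[OF r1(2) vK(3) zQ]) (auto simp: K_def)
    have "connected_component (- (Q1 \<union> Q3)) a2 y"
      by (rule outer[OF p2(2) tK(2) yQ]) (auto simp: K_def)
    moreover have "connected_component (- (Q1 \<union> Q3)) a1 a2"
      by (rule connected_component_of_subset[OF c12]) (auto simp: K_def)
    ultimately show "connected_component (- (Q1 \<union> Q3)) a1 y"
      using connected_component_trans by metis
  qed
qed

section \<open>Complete bipartite graphs in simple topological graphs\<close>

lemma edge_endpoints:
  assumes G: "topological_graph G" and e: "e \<in> edges G" "u \<in> e" "v \<in> e" "u \<in> verts G" "v \<in> verts G" "u \<noteq> v"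
  shows "arc_between e u v" "e \<inter> verts G = {u, v}"
proof -
  have "\<exists>g. arc g \<and> path_image g = e \<and> e \<inter> verts G = {pathstart g, pathfinish g}"
    using G e(1) by (simp add: topological_graph_def)
  then obtain g where g: "arc g" "path_image g = e" "e \<inter> verts G = {pathstart g, pathfinish g}"
    by (elim exE conjE)
  have arc: "arc_between e (pathstart g) (pathfinish g)"
    unfolding arc_between_def by (intro exI[of _ g] conjI g refl)
  have "u \<in> e \<inter> verts G" "v \<in> e \<inter> verts G" using e by simp_all
  then have "u \<in> {pathstart g, pathfinish g}" "v \<in> {pathstart g, pathfinish g}"
    by (simp_all only: g(3))
  then consider "u = pathstart g" "v = pathfinish g" | "u = pathfinish g" "v = pathstart g"
    using e(6) by auto
  then have "arc_between e u v \<and> e \<inter> verts G = {u, v}"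
  proof cases
    case 1
    show ?thesis unfolding 1 using arc g(3) by simp
  next
    case 2
    show ?thesis unfolding 2 using arc_between_sym[OF arc] g(3) by (simp add: insert_commute)
  qed
  then show "arc_between e u v" "e \<inter> verts G = {u, v}" by simp_all
qed

text \<open>
  The edge joining two vertices is made a function of them, so that crossings can be discussed in terms
  of vertices; the values of \<open>E\<close> outside \<open>A \<times> B\<close> are arbitrary.
\<close>

locale complete_bipartite_drawing =
  fixes G :: topgraph and A B :: "complex set" and E :: "complex \<Rightarrow> complex \<Rightarrow> complex set"
  assumes simple: "simple_topological_graph G"
    and parts: "A \<subseteq> verts G" "B \<subseteq> verts G" "A \<inter> B = {}"
    and edge: "\<And>a b. a \<in> A \<Longrightarrow> b \<in> B \<Longrightarrow> E a b \<in> edges G \<and> a \<in> E a b \<and> b \<in> E a b"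
begin

lemma topological: "topological_graph G"
  using simple by (simp add: simple_topological_graph_def)

lemma arc_E: "arc_between (E a b) a b"
  and E_verts: "E a b \<inter> verts G = {a, b}" if "a \<in> A" "b \<in> B"
proof -
  have ne: "a \<noteq> b" and v: "a \<in> verts G" "b \<in> verts G" using that parts by auto
  have e: "E a b \<in> edges G" "a \<in> E a b" "b \<in> E a b" using edge[OF that] by simp_all
  show "arc_between (E a b) a b" "E a b \<inter> verts G = {a, b}"
    by (fact edge_endpoints[OF topological e v ne])+
qed

lemma E_inject:
  assumes "a \<in> A" "b \<in> B" "a' \<in> A" "b' \<in> B" "E a b = E a' b'"
  shows "a = a'" "b = b'"
proof -
  have "{a, b} = {a', b'}"
    using E_verts[OF assms(1,2)] E_verts[OF assms(3,4)] assms(5) by simp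
  moreover have "a \<noteq> b'" "b \<noteq> a'" using assms(1-4) parts(3) by auto
  ultimately show "a = a'" "b = b'" by (auto simp: doubleton_eq_iff)
qed

lemma Int_eq_singleton:
  assumes "e \<in> edges G" "f \<in> edges G" "e \<noteq> f" "x \<in> e" "x \<in> f"
  shows "e \<inter> f = {x}"
proof -
  have "\<forall>e\<in>edges G. \<forall>f\<in>edges G. e \<noteq> f \<longrightarrow> (\<forall>p \<in> e \<inter> f. \<forall>q \<in> e \<inter> f. p = q)"
    using simple unfolding simple_topological_graph_def by (rule conjunct2)
  note uniq = this[rule_format, OF assms(1-3)]
  show ?thesis
  proof (intro equalityI subsetI)
    fix p assume "p \<in> e \<inter> f"
    then have "p = x" by (rule uniq) (rule IntI[OF assms(4,5)])
    then show "p \<in> {x}" by simp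
  qed (use assms(4,5) in simp)
qed

lemma Int_same_left:
  assumes "a \<in> A" "b \<in> B" "b' \<in> B" "b \<noteq> b'"
  shows "E a b \<inter> E a b' = {a}"
proof (rule Int_eq_singleton)
  show "E a b \<noteq> E a b'" using E_inject(2)[OF assms(1,2,1,3)] assms(4) by blast
qed (simp_all add: edge assms)

lemma Int_same_right:
  assumes "a \<in> A" "a' \<in> A" "b \<in> B" "a \<noteq> a'"
  shows "E a b \<inter> E a' b = {b}"
proof (rule Int_eq_singleton)
  show "E a b \<noteq> E a' b" using E_inject(1)[OF assms(1,3,2,3)] assms(4) by blast
qed (simp_all add: edge assms)

lemma Int_crossing:
  assumes "a \<in> A" "a' \<in> A" "b \<in> B" "b' \<in> B" "a \<noteq> a' \<or> b \<noteq> b'" "edges_cross (E a b) (E a' b')"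
  shows "\<exists>x. E a b \<inter> E a' b' = {x} \<and> proper_crossing (E a b) (E a' b') x"
proof -
  obtain x where x: "proper_crossing (E a b) (E a' b') x"
    using assms(6) unfolding edges_cross_def by blast
  have ne: "E a b \<noteq> E a' b'" using E_inject[OF assms(1,3,2,4)] assms(5) by blast
  then have "E a b \<inter> E a' b' = {x}"
    by (intro Int_eq_singleton ne proper_crossing_mem[OF x]) (simp_all add: edge assms)
  then show ?thesis using x by (intro exI[of _ x] conjI)
qed

text \<open>
  In a topological graph a common point of two edges other than a vertex is a proper crossing, and two
  edges without common endpoint do not share a vertex.
\<close>

lemma Int_no_crossing:
  assumes "a \<in> A" "a' \<in> A" "b \<in> B" "b' \<in> B" "a \<noteq> a'" "b \<noteq> b'" "\<not> edges_cross (E a b) (E a' b')"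
  shows "E a b \<inter> E a' b' = {}"
proof (rule ccontr)
  assume "E a b \<inter> E a' b' \<noteq> {}"
  then obtain p where p: "p \<in> E a b" "p \<in> E a' b'" by blast
  have ne: "E a b \<noteq> E a' b'" using E_inject[OF assms(1,3,2,4)] assms(5) by blast
  then have "p \<in> verts G"
    using topological p assms(7) edge[OF assms(1,3)] edge[OF assms(2,4)] ne
    unfolding topological_graph_def edges_cross_def by (metis DiffI IntI)
  then have "p \<in> {a, b}" "p \<in> {a', b'}"
    using p E_verts[OF assms(1,3)] E_verts[OF assms(2,4)] by (metis IntI)+
  then show False using assms parts(3) by auto
qed

lemma adjacent_not_cross:
  assumes "a \<in> A" "a' \<in> A" "b \<in> B" "b' \<in> B" "a = a' \<and> b \<noteq> b' \<or> a \<noteq> a' \<and> b = b'"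
  shows "\<not> edges_cross (E a b) (E a' b')"
proof
  assume "edges_cross (E a b) (E a' b')"
  then obtain x where x: "E a b \<inter> E a' b' = {x}" "proper_crossing (E a b) (E a' b') x"
    using Int_crossing[OF assms(1-4)] assms(5) by metis
  have "x \<noteq> a" "x \<noteq> b"
    using proper_crossing_interior[OF x(2) arc_E[OF assms(1,3)] arc_E[OF assms(2,4)]] by auto
  moreover have "x = a \<or> x = b"
    using assms(5)
  proof
    assume "a = a' \<and> b \<noteq> b'"
    then show ?thesis using x(1) Int_same_left[OF assms(1,3,4)] by auto
  next
    assume "a \<noteq> a' \<and> b = b'"
    then show ?thesis using x(1) Int_same_right[OF assms(1,2,3)] by auto
  qed
  ultimately show False by blast
qed

lemma crossings_antisymmetric:
  assumes "a \<in> A" "a' \<in> A" "b \<in> B" "b' \<in> B" "a \<noteq> a'" "b \<noteq> b'"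
    and "edges_cross (E a b) (E a' b')"
  shows "\<not> edges_cross (E a' b) (E a b')"
proof
  assume "edges_cross (E a' b) (E a b')"
  then obtain y where y: "E a' b \<inter> E a b' = {y}" "proper_crossing (E a' b) (E a b') y"
    using Int_crossing[OF assms(2,1,3,4)] assms(5) by metis
  obtain x where x: "E a b \<inter> E a' b' = {x}" "proper_crossing (E a b) (E a' b') x"
    using Int_crossing[OF assms(1-4)] assms(5,7) by metis
  show False
    by (rule no_thrackle_C4[OF arc_E arc_E arc_E arc_E Int_same_right Int_same_right
          Int_same_left Int_same_left x y]) (use assms in auto)
qed

lemma some_crossing:
  assumes A: "a1 \<in> A" "a2 \<in> A" "a3 \<in> A" "a1 \<noteq> a2" "a1 \<noteq> a3" "a2 \<noteq> a3"
    and B: "b1 \<in> B" "b2 \<in> B" "b3 \<in> B" "b1 \<noteq> b2" "b1 \<noteq> b3" "b2 \<noteq> b3"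
  shows "\<exists>a\<in>{a1,a2,a3}. \<exists>a'\<in>{a1,a2,a3}. \<exists>b\<in>{b1,b2,b3}. \<exists>b'\<in>{b1,b2,b3}.
    a \<noteq> a' \<and> b \<noteq> b' \<and> edges_cross (E a b) (E a' b')"
proof (rule ccontr)
  assume no: "\<not> ?thesis"
  define X where "X = {a1,a2,a3}"
  define Y where "Y = {b1,b2,b3}"
  have X: "X \<subseteq> A" "a1 \<in> X" "a2 \<in> X" "a3 \<in> X" and Y: "Y \<subseteq> B" "b1 \<in> Y" "b2 \<in> Y" "b3 \<in> Y"
    using A B by (simp_all add: X_def Y_def)
  have disj: "E a b \<inter> E a' b' = {}"
    if "a \<in> X" "a' \<in> X" "b \<in> Y" "b' \<in> Y" "a \<noteq> a'" "b \<noteq> b'" for a a' b b'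
  proof (rule Int_no_crossing)
    show "\<not> edges_cross (E a b) (E a' b')"
      using no that unfolding X_def[symmetric] Y_def[symmetric] by metis
  qed (use that X(1) Y(1) in auto)
  show False
    by (rule no_plane_K33[where a = a1 and a' = a2 and q = a3 and ?b1.0 = b1 and ?b2.0 = b2 and ?b3.0 = b3
          and ?p1.0 = "E a1 b1" and ?p2.0 = "E a1 b2" and ?p3.0 = "E a1 b3"
          and p1' = "E a2 b1" and p2' = "E a2 b2" and p3' = "E a2 b3"
          and ?r1.0 = "E a3 b1" and ?r2.0 = "E a3 b2" and ?r3.0 = "E a3 b3"])
      (use A B X Y in \<open>simp_all add: arc_E Int_same_left Int_same_right Int_Un_distrib disj\<close>)
qed

lemma crossings_acyclic:
  assumes A: "a1 \<in> A" "a2 \<in> A" "a3 \<in> A" "a1 \<noteq> a2" "a1 \<noteq> a3" "a2 \<noteq> a3"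
    and B: "b \<in> B" "b' \<in> B" "b \<noteq> b'"
    and cross: "edges_cross (E a1 b) (E a2 b')" "edges_cross (E a2 b) (E a3 b')"
  shows "\<not> edges_cross (E a3 b) (E a1 b')"
proof
  assume c3: "edges_cross (E a3 b) (E a1 b')"
  obtain x where x: "E a1 b \<inter> E a2 b' = {x}" "proper_crossing (E a1 b) (E a2 b') x"
    using Int_crossing[OF A(1,2) B(1,2)] cross(1) A(4) by metis
  obtain y where y: "E a2 b \<inter> E a3 b' = {y}" "proper_crossing (E a2 b) (E a3 b') y"
    using Int_crossing[OF A(2,3) B(1,2)] cross(2) A(6) by metis
  obtain z where z: "E a3 b \<inter> E a1 b' = {z}" "proper_crossing (E a3 b) (E a1 b') z"
    using Int_crossing[OF A(3,1) B(1,2)] c3 A(5) by metis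
  have "\<not> edges_cross (E a2 b) (E a1 b')" "\<not> edges_cross (E a3 b) (E a2 b')"
    "\<not> edges_cross (E a1 b) (E a3 b')"
    using crossings_antisymmetric[OF A(1,2) B(1,2)] crossings_antisymmetric[OF A(2,3) B(1,2)]
      crossings_antisymmetric[OF A(3,1) B(1,2)] cross c3 A B by auto
  then have disj: "E a2 b \<inter> E a1 b' = {}" "E a3 b \<inter> E a2 b' = {}" "E a1 b \<inter> E a3 b' = {}"
    using Int_no_crossing[OF A(2,1) B(1,2)] Int_no_crossing[OF A(3,2) B(1,2)]
      Int_no_crossing[OF A(1,3) B(1,2)] A B(3) by auto
  show False
    by (rule no_cyclic_tripods[where b = b and b' = b' and ?a1.0 = a1 and ?a2.0 = a2 and ?a3.0 = a3
          and ?p1.0 = "E a1 b" and ?p2.0 = "E a2 b" and ?p3.0 = "E a3 b"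
          and ?r1.0 = "E a1 b'" and ?r2.0 = "E a2 b'" and ?r3.0 = "E a3 b'"])
      (use A B disj x y z in \<open>simp_all add: arc_between_sym arc_E Int_same_left Int_same_right\<close>)
qed

end

section \<open>Straight segments between two parallel lines\<close>

abbreviation seg :: "real \<Rightarrow> real \<Rightarrow> complex set" where
  "seg y z \<equiv> closed_segment (Complex 0 y) (Complex 1 z)"

lemma in_seg_iff: "p \<in> seg y z \<longleftrightarrow> 0 \<le> Re p \<and> Re p \<le> 1 \<and> Im p = y + Re p * (z - y)"
proof
  assume "p \<in> seg y z"
  then obtain u where "0 \<le> u" "u \<le> 1" "p = (1 - u) *\<^sub>R Complex 0 y + u *\<^sub>R Complex 1 z"
    unfolding in_segment by blast
  then have "0 \<le> u" "u \<le> 1" "Re p = u" "Im p = (1 - u) * y + u * z" by simp_all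
  then show "0 \<le> Re p \<and> Re p \<le> 1 \<and> Im p = y + Re p * (z - y)"
    by (simp add: algebra_simps)
next
  assume "0 \<le> Re p \<and> Re p \<le> 1 \<and> Im p = y + Re p * (z - y)"
  then show "p \<in> seg y z"
    unfolding in_segment by (intro exI[of _ "Re p"]) (auto simp: complex_eq_iff algebra_simps)
qed

lemma arc_between_seg: "arc_between (seg y z) (Complex 0 y) (Complex 1 z)"
  unfolding arc_between_def
  by (intro exI[of _ "linepath (Complex 0 y) (Complex 1 z)"]) (auto intro: arc_linepath)

lemma seg_cross_imp:
  assumes "(y, z) \<noteq> (y', z')" "edges_cross (seg y z) (seg y' z')"
  shows "(y - y') * (z - z') < 0"
proof -
  obtain p where p: "proper_crossing (seg y z) (seg y' z') p"
    using assms by (auto simp: edges_cross_def)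
  have m: "p \<in> seg y z" "p \<in> seg y' z'" using proper_crossing_mem[OF p] by auto
  have "p \<noteq> Complex 0 y" "p \<noteq> Complex 1 z"
    using proper_crossing_interior[OF p arc_between_seg arc_between_seg] by auto
  then have r: "0 < Re p" "Re p < 1" using m(1) by (auto simp: in_seg_iff complex_eq_iff less_le)
  have eq: "(y - y') * (1 - Re p) = - ((z - z') * Re p)"
    using m by (auto simp: in_seg_iff algebra_simps)
  have "y \<noteq> y'"
  proof
    assume "y = y'"
    then have "z = z'" using eq r by auto
    then show False using assms(1) \<open>y = y'\<close> by simp
  qed
  have "((y - y') * (z - z')) * Re p = - ((y - y')\<^sup>2 * (1 - Re p))"
    unfolding mult.assoc minus_equation_iff[THEN iffD1, OF eq[symmetric], symmetric]
    by (simp add: power2_eq_square)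
  also have "\<dots> < 0" using r \<open>y \<noteq> y'\<close> by simp
  finally show ?thesis using r(1) by (simp add: mult_less_0_iff)
qed

text \<open>
  The chart is the affine map whose coordinates are the vertical distances from the two segments. Its
  scale \<open>\<rho>\<close> is chosen so that the preimage of the unit disc stays in the strip between the two
  lines; there the segments coincide with the lines spanned by them. The abscissa of the crossing is
  \<open>r\<close>.
\<close>

lemma seg_crossing:
  assumes "(y - y') * (z - z') < 0"
  shows "edges_cross (seg y z) (seg y' z')"
proof -
  define D where "D = (y' - y) + (z - z')"
  define r where "r = (y' - y) / D"
  have s: "(y' > y \<and> z > z') \<or> (y' < y \<and> z < z')" using assms by (auto simp: mult_less_0_iff)
  then have D: "D \<noteq> 0" by (auto simp: D_def)
  have r: "0 < r" "r < 1" using s by (auto simp: r_def D_def divide_simps)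
  define \<rho> where "\<rho> = \<bar>D\<bar> * min r (1 - r) / 2"
  have \<rho>: "\<rho> > 0" using r D by (simp add: \<rho>_def)
  define h where "h p = Complex ((Im p - y' - Re p * (z' - y')) / \<rho>) ((Im p - y - Re p * (z - y)) / \<rho>)" for p
  define g where "g w = (let R = r + (Re w - Im w) * \<rho> / D in Complex R (Im w * \<rho> + y + R * (z - y)))" for w
  have lin: "Im p - y - Re p * (z - y) - (Im p - y' - Re p * (z' - y')) = D * (r - Re p)" for p
  proof -
    have "D * r = y' - y" using D by (simp add: r_def)
    then have "D * (r - Re p) = y' - y - D * Re p" by (simp only: right_diff_distrib)
    then show ?thesis by (simp add: D_def algebra_simps)
  qed
  have h\<rho>: "Re (h p) * \<rho> = Im p - y' - Re p * (z' - y')"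
    "Im (h p) * \<rho> = Im p - y - Re p * (z - y)" for p
    using \<rho> by (simp_all add: h_def)
  have gh: "g (h p) = p" for p
  proof -
    have "(Re (h p) - Im (h p)) * \<rho> = - (D * (r - Re p))"
      using h\<rho>[of p] lin[of p] by (simp only: left_diff_distrib)
    then have "r + (Re (h p) - Im (h p)) * \<rho> / D = Re p" using D by (simp add: field_simps)
    then show ?thesis using \<rho> by (simp add: g_def Let_def h_def complex_eq_iff)
  qed
  have hg: "h (g w) = w" for w
  proof -
    define R where "R = r + (Re w - Im w) * \<rho> / D"
    have g: "g w = Complex R (Im w * \<rho> + y + R * (z - y))" by (simp add: g_def R_def Let_def)
    have im: "Im (h (g w)) * \<rho> = Im w * \<rho>" unfolding h\<rho> by (simp add: g)
    have "Re (h q) * \<rho> = Im (h q) * \<rho> - D * (r - Re q)" for q using h\<rho>[of q] lin[of q] by linarith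
    then have "Re (h (g w)) * \<rho> = Im (h (g w)) * \<rho> - D * (r - R)" by (simp add: g)
    also have "D * (r - R) = - ((Re w - Im w) * \<rho>)" using D by (simp add: R_def)
    finally have "Re (h (g w)) * \<rho> = Im (h (g w)) * \<rho> + (Re w - Im w) * \<rho>" by simp
    then have "Re (h (g w)) * \<rho> = Re w * \<rho>" unfolding im by (simp add: left_diff_distrib)
    then show ?thesis using im \<rho> by (simp add: complex_eq_iff)
  qed
  have ch: "continuous_on S h" for S unfolding h_def complex_eq_iff Complex_eq
    using \<rho> by (intro continuous_intros) auto
  have cg: "continuous_on S g" for S unfolding g_def Let_def Complex_eq
    using D by (intro continuous_intros) auto
  define U where "U = h -` ball 0 1"
  have "open U" unfolding U_def using ch by (intro open_vimage) auto
  have hom: "homeomorphism U (ball 0 1) h g"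
    by (rule homeomorphismI[OF ch cg]) (auto simp: U_def gh hg)
  define p0 where "p0 = g 0"
  have hp0: "h p0 = 0" by (simp add: p0_def hg)
  have Re01: "0 \<le> Re p \<and> Re p \<le> 1" if "p \<in> U" for p
  proof -
    define w where "w = h p"
    have "cmod w < 1" using that by (simp add: U_def w_def)
    then have "\<bar>Re w\<bar> < 1" "\<bar>Im w\<bar> < 1" using abs_Re_le_cmod[of w] abs_Im_le_cmod[of w] by linarith+
    then have "\<bar>Re w - Im w\<bar> * \<rho> < 2 * \<rho>" using \<rho> by (intro mult_strict_right_mono) linarith+
    then have "\<bar>(Re w - Im w) * \<rho> / D\<bar> < 2 * \<rho> / \<bar>D\<bar>"
      using D \<rho> by (simp add: abs_mult divide_strict_right_mono)
    also have "\<dots> = min r (1 - r)" using D by (simp add: \<rho>_def)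
    finally have "\<bar>(Re w - Im w) * \<rho> / D\<bar> < r \<and> \<bar>(Re w - Im w) * \<rho> / D\<bar> < 1 - r" by simp
    moreover have "Re p = r + (Re w - Im w) * \<rho> / D"
      using gh[of p] unfolding w_def[symmetric] g_def Let_def by (metis complex.sel(1))
    moreover have "0 < r + X \<and> r + X < 1" if "\<bar>X\<bar> < r \<and> \<bar>X\<bar> < 1 - r" for X
      using that by auto
    ultimately have "0 < Re p \<and> Re p < 1" by metis
    then show ?thesis by simp
  qed
  have 1: "p \<in> seg y z \<longleftrightarrow> Im (h p) = 0" if "p \<in> U" for p
    using Re01[OF that] \<rho> by (auto simp: in_seg_iff h_def algebra_simps)
  have 2: "p \<in> seg y' z' \<longleftrightarrow> Re (h p) = 0" if "p \<in> U" for p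
    using Re01[OF that] \<rho> by (auto simp: in_seg_iff h_def algebra_simps)
  have im: "h ` (S \<inter> U) = {w \<in> ball 0 1. P w}" if "\<And>p. p \<in> U \<Longrightarrow> p \<in> S \<longleftrightarrow> P (h p)" for S P
  proof (intro equalityI subsetI)
    fix w assume w: "w \<in> {w \<in> ball 0 1. P w}"
    then have "g w \<in> U" by (simp add: U_def hg)
    then show "w \<in> h ` (S \<inter> U)" using w that[of "g w"] hg by (intro image_eqI[of _ _ "g w"]) auto
  qed (use that in \<open>auto simp: U_def\<close>)
  have "proper_crossing (seg y z) (seg y' z') p0"
    unfolding proper_crossing_def
    by (intro exI[of _ U] exI[of _ h] exI[of _ g] conjI im 1 2 hom hp0 \<open>open U\<close>)
      (auto simp: U_def hp0)
  then show ?thesis by (auto simp: edges_cross_def)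
qed

lemma seg_cross_iff:
  assumes "(y, z) \<noteq> (y', z')"
  shows "edges_cross (seg y z) (seg y' z') \<longleftrightarrow> (y - y') * (z - z') < 0"
  using assms seg_cross_imp seg_crossing by blast

lemma seg_inject: "seg y z = seg y' z' \<longleftrightarrow> y = y' \<and> z = z'"
proof
  assume eq: "seg y z = seg y' z'"
  have "Complex 0 y \<in> seg y' z'" "Complex 1 z \<in> seg y' z'" unfolding eq[symmetric] by auto
  then show "y = y' \<and> z = z'" by (auto simp: in_seg_iff)
qed auto

section \<open>Extremal and Ramsey-type combinatorics\<close>

text \<open>
  Jensen's inequality for the power function.
\<close>

lemma power_mean_sum:
  fixes d :: "'a \<Rightarrow> real"
  assumes "finite V" "V \<noteq> {}" "\<And>v. v \<in> V \<Longrightarrow> d v \<ge> 0"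
  shows "real (card V) * ((\<Sum>v\<in>V. d v) / card V) ^ s \<le> (\<Sum>v\<in>V. d v ^ s)"
proof -
  have conv: "convex_on {0::real..} (\<lambda>x. x ^ s)"
    using convex_power_odd[of s] convex_on_subset[OF convex_power_even[of s], of "{0..}"]
    by (cases "even s") auto
  have n: "real (card V) > 0" using assms by (simp add: card_gt_0_iff)
  have "(\<Sum>v\<in>V. (1 / card V) *\<^sub>R d v) ^ s \<le> (\<Sum>v\<in>V. (1 / card V) * d v ^ s)"
    by (rule convex_on_sum[OF assms(1,2) conv]) (use assms n in auto)
  then show ?thesis using n
    by (simp add: field_simps flip: sum_divide_distrib sum_distrib_left)
qed

text \<open>
  Count the pairs of a vertex and a set of \<open>s\<close> of its neighbours. Each \<open>s\<close>-set is counted at most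
  \<open>t\<close> times, whereas by convexity there are many such pairs if the average degree is large. Using
  \<open>(d/s)\<^sup>s \<le> (d choose s) + 1\<close>, which holds also for \<open>d < s\<close>, avoids a separate treatment of
  vertices of small degree.
\<close>

theorem kovari_sos_turan:
  fixes adj :: "'a \<Rightarrow> 'a \<Rightarrow> bool"
  assumes fin: "finite V" "V \<noteq> {}" and s: "s \<ge> 1"
    and free: "\<And>A. A \<subseteq> V \<Longrightarrow> card A = s \<Longrightarrow> card {v \<in> V. \<forall>a\<in>A. adj v a} \<le> t"
  shows "real (\<Sum>v\<in>V. card {u \<in> V. adj v u})
    \<le> s * real (t + 1) powr (1 / s) * card V powr (2 - 1 / s)"
proof -
  define n where "n = real (card V)"
  define d where "d v = card {u \<in> V. adj v u}" for v
  define \<S> where "\<S> = {A. A \<subseteq> V \<and> card A = s}"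
  have n1: "n \<ge> 1" using fin unfolding n_def by (simp add: Suc_le_eq card_gt_0_iff)
  have finS: "finite \<S>" using fin by (simp add: \<S>_def)
  have "(\<Sum>v\<in>V. d v choose s) = (\<Sum>v\<in>V. card {A \<in> \<S>. \<forall>a\<in>A. adj v a})"
  proof (rule sum.cong)
    fix v assume "v \<in> V"
    have "{A \<in> \<S>. \<forall>a\<in>A. adj v a} = {A. A \<subseteq> {u \<in> V. adj v u} \<and> card A = s}"
      by (auto simp: \<S>_def)
    then show "d v choose s = card {A \<in> \<S>. \<forall>a\<in>A. adj v a}"
      using fin by (simp add: n_subsets d_def)
  qed simp
  also have "\<dots> = (\<Sum>A\<in>\<S>. card {v \<in> V. \<forall>a\<in>A. adj v a})"
    by (rule sum_multicount_gen) (use fin finS in auto)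
  also have "\<dots> \<le> (\<Sum>A\<in>\<S>. t)"
    by (rule sum_mono) (use free in \<open>auto simp: \<S>_def\<close>)
  also have "\<dots> = (card V choose s) * t"
    using fin by (simp add: \<S>_def n_subsets)
  also have "\<dots> \<le> card V ^ s * t"
  proof (cases "s \<le> card V")
    case True then show ?thesis by (intro mult_right_mono binomial_le_pow) auto
  qed (simp add: binomial_eq_0)
  finally have "real (\<Sum>v\<in>V. d v choose s) \<le> real (card V ^ s * t)"
    by (rule of_nat_mono)
  then have up: "(\<Sum>v\<in>V. real (d v choose s)) \<le> n ^ s * t" by (simp add: n_def)
  have low: "(real (d v) / s) ^ s \<le> real (d v choose s) + 1" for v
  proof (cases "s \<le> d v")
    case True
    then show ?thesis using binomial_ge_n_over_k_pow_k[of s "d v", where 'a = real] by simp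
  next
    case False
    then have "(real (d v) / s) ^ s \<le> 1" using s by (intro power_le_one) auto
    then show ?thesis by (simp add: add_increasing)
  qed
  define D where "D = (\<Sum>v\<in>V. real (d v))"
  have D0: "D \<ge> 0" unfolding D_def by (simp add: sum_nonneg)
  have s0: "real s > 0" using s by simp
  have "n * (D / (s * n)) ^ s = n * ((\<Sum>v\<in>V. real (d v) / s) / card V) ^ s"
    by (simp add: D_def n_def flip: sum_divide_distrib)
  also have "\<dots> \<le> (\<Sum>v\<in>V. (real (d v) / s) ^ s)"
    unfolding n_def by (rule power_mean_sum) (use fin in auto)
  also have "\<dots> \<le> (\<Sum>v\<in>V. real (d v choose s) + 1)" by (rule sum_mono) (rule low)
  also have "\<dots> \<le> n ^ s * t + n" using up by (simp add: sum.distrib n_def)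
  also have "\<dots> \<le> (t + 1) * n ^ s"
    using self_le_power[of n s] n1 s by (simp add: algebra_simps)
  finally have "(D / (s * n)) ^ s \<le> (t + 1) * n ^ s / n" using n1 by (simp add: field_simps)
  also have "\<dots> = (t + 1) * n powr (real s - 1)"
    using n1 by (simp add: powr_diff powr_realpow)
  finally have "root s ((D / (s * n)) ^ s) \<le> root s ((t + 1) * n powr (real s - 1))"
    using s by simp
  then have "D / (s * n) \<le> root s ((t + 1) * n powr (real s - 1))"
    using s D0 n1 by (simp add: real_root_power_cancel)
  also have "\<dots> = ((t + 1) * n powr (real s - 1)) powr (1 / s)"
    using s n1 by (intro root_powr_inverse) auto
  also have "\<dots> = (t + 1) powr (1 / s) * n powr ((real s - 1) * (1 / s))"
    using n1 by (simp add: powr_mult powr_powr)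
  also have "(real s - 1) * (1 / s) = 1 - 1 / s" using s by (simp add: field_simps)
  finally have "D \<le> s * n * ((t + 1) powr (1 / s) * n powr (1 - 1 / s))"
    using s n1 by (simp add: field_simps)
  also have "\<dots> = s * (t + 1) powr (1 / s) * (n powr 1 * n powr (1 - 1 / s))"
    using n1 by simp
  also have "n powr 1 * n powr (1 - 1 / s) = n powr (2 - 1 / s)"
    by (subst powr_add[symmetric]) simp
  finally show ?thesis by (simp add: D_def d_def n_def add.commute)
qed

text \<open>
  Ramsey's theorem for pairs, with an arbitrary set of \<open>q\<close> colours; the bound depends on \<open>q\<close> and
  \<open>M\<close> only.
\<close>

lemma ramsey_pairs:
  fixes M q :: nat
  shows "\<exists>N::nat. \<forall>(K :: 'c set) f. finite K \<longrightarrow> card K = q \<longrightarrow> (\<forall>i j. i < j \<longrightarrow> j < N \<longrightarrow> f i j \<in> K) \<longrightarrow>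
    (\<exists>H c. H \<subseteq> {..<N} \<and> card H = M \<and> (\<forall>i\<in>H. \<forall>j\<in>H. i < j \<longrightarrow> f i j = c))"
proof -
  obtain N :: nat where N: "partn_lst {..<N} (replicate q M) 2"
    using ramsey_full by blast
  show ?thesis
  proof (intro exI[of _ N] allI impI)
    fix K :: "'c set" and f :: "nat \<Rightarrow> nat \<Rightarrow> 'c"
    assume K: "finite K" "card K = q" and f: "\<forall>i j. i < j \<longrightarrow> j < N \<longrightarrow> f i j \<in> K"
    obtain g where g: "bij_betw g K {..<q}"
      using K ex_bij_betw_finite_nat by (metis atLeast0LessThan)
    define F where "F e = g (f (Min e) (Max e))" for e
    have F: "F {i, j} = g (f i j)" if "i < j" for i j
      using that by (simp add: F_def min_def max_def)
    have "F \<in> [{..<N}]\<^bsup>2\<^esup> \<rightarrow> {..<q}"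
    proof
      fix e assume "e \<in> [{..<N}]\<^bsup>2\<^esup>"
      then obtain i j where "e = {i, j}" "i < j" "j < N" by (auto simp: ordered_nsets_2_eq)
      then show "F e \<in> {..<q}" using F f g by (auto simp: bij_betw_def)
    qed
    then obtain c H where H: "c < q" "H \<in> [{..<N}]\<^bsup>M\<^esup>" "F ` [H]\<^bsup>2\<^esup> \<subseteq> {c}"
      using partn_lstE[OF N, of F q] by (metis length_replicate nth_replicate)
    show "\<exists>H c. H \<subseteq> {..<N} \<and> card H = M \<and> (\<forall>i\<in>H. \<forall>j\<in>H. i < j \<longrightarrow> f i j = c)"
    proof (intro exI conjI ballI impI)
      show "H \<subseteq> {..<N}" "card H = M" using H by (auto simp: nsets_def)
      fix i j assume ij: "i \<in> H" "j \<in> H" "i < j"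
      then have "F {i, j} = c" using H(3) by (auto simp: image_subset_iff)
      moreover have "f i j \<in> K" using f ij \<open>H \<subseteq> {..<N}\<close> by auto
      ultimately show "f i j = inv_into K g c"
        using F[OF ij(3)] g by (metis bij_betw_def inv_into_f_f)
    qed
  qed
qed

text \<open>
  The quadratic bound for the Ramsey number \<open>R(3, k)\<close>. The non-neighbours of a vertex form a clique;
  if they are at most \<open>k\<close>, then enough neighbours remain to continue with them.
\<close>

lemma clique_of_no_independent_triple:
  assumes "finite X" "k * (k + 1) \<le> 2 * card X"
    and sym: "\<And>x y. R x y \<Longrightarrow> R y x"
    and "\<And>x y z. x \<in> X \<Longrightarrow> y \<in> X \<Longrightarrow> z \<in> X \<Longrightarrow> x \<noteq> y \<Longrightarrow> x \<noteq> z \<Longrightarrow> y \<noteq> z \<Longrightarrow> R x y \<or> R x z \<or> R y z"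
  shows "\<exists>Y\<subseteq>X. card Y = k \<and> (\<forall>x\<in>Y. \<forall>y\<in>Y. x \<noteq> y \<longrightarrow> R x y)"
  using assms(1,2,4)
proof (induction k arbitrary: X)
  case 0
  then show ?case by (intro exI[of _ "{}"]) auto
next
  case (Suc k)
  from Suc.prems(2) have "X \<noteq> {}" by auto
  then obtain v where v: "v \<in> X" by blast
  define P where "P = {x \<in> X - {v}. R v x}"
  define Q where "Q = {x \<in> X - {v}. \<not> R v x}"
  have fin: "finite P" "finite Q" using Suc.prems by (auto simp: P_def Q_def)
  have "X = insert v (P \<union> Q)" using v by (auto simp: P_def Q_def)
  moreover have "card (insert v (P \<union> Q)) = Suc (card P + card Q)"
    using fin by (subst card_insert_disjoint) (auto simp: P_def Q_def intro!: card_Un_disjoint)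
  ultimately have card: "card X = Suc (card P + card Q)" by simp
  show ?case
  proof (cases "card Q \<ge> Suc k")
    case True
    then obtain Y where Y: "Y \<subseteq> Q" "card Y = Suc k" by (meson obtain_subset_with_card_n)
    have "R x y" if "x \<in> Y" "y \<in> Y" "x \<noteq> y" for x y
      using Suc.prems(3)[of v x y] that Y v by (auto simp: Q_def)
    then show ?thesis using Y by (intro exI[of _ Y]) (auto simp: Q_def)
  next
    case False
    then have "k * (k + 1) \<le> 2 * card P" using card Suc.prems(2) by simp
    then obtain Y where Y: "Y \<subseteq> P" "card Y = k" "\<forall>x\<in>Y. \<forall>y\<in>Y. x \<noteq> y \<longrightarrow> R x y"
      using Suc.IH[of P] fin Suc.prems(3) by (auto simp: P_def)
    have "v \<notin> Y" "finite Y" using Y fin by (auto simp: P_def intro: finite_subset)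
    then show ?thesis using Y v sym by (intro exI[of _ "insert v Y"]) (auto simp: P_def)
  qed
qed

text \<open>
  A tournament without cyclic triples is transitive, so the number of successors of a vertex
  determines its place.
\<close>

lemma acyclic_tournament_rank:
  assumes fin: "finite Y"
    and total: "\<And>x y. x \<in> Y \<Longrightarrow> y \<in> Y \<Longrightarrow> x \<noteq> y \<Longrightarrow> c x y \<or> c y x"
    and asym: "\<And>x y. x \<in> Y \<Longrightarrow> y \<in> Y \<Longrightarrow> x \<noteq> y \<Longrightarrow> \<not> (c x y \<and> c y x)"
    and acyclic: "\<And>x y z. x \<in> Y \<Longrightarrow> y \<in> Y \<Longrightarrow> z \<in> Y \<Longrightarrow> x \<noteq> y \<Longrightarrow> x \<noteq> z \<Longrightarrow> y \<noteq> z \<Longrightarrow>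
      \<not> (c x y \<and> c y z \<and> c z x)"
  shows "\<exists>r :: 'a \<Rightarrow> nat. bij_betw r Y {..<card Y} \<and>
    (\<forall>x\<in>Y. \<forall>y\<in>Y. x \<noteq> y \<longrightarrow> (c x y \<longleftrightarrow> r y < r x))"
proof -
  define S where "S a = {x \<in> Y. x \<noteq> a \<and> c a x}" for a
  define r where "r a = card (S a)" for a
  have lt: "r b < r a" if ab: "a \<in> Y" "b \<in> Y" "a \<noteq> b" "c a b" for a b
  proof -
    have "x \<in> S a" if x: "x \<in> S b" for x
    proof -
      have x': "x \<in> Y" "x \<noteq> b" "c b x" using x by (auto simp: S_def)
      have "x \<noteq> a" using x' ab asym by blast
      moreover have "\<not> c x a" using acyclic[of a b x] ab x' \<open>x \<noteq> a\<close> by blast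
      ultimately show ?thesis using total[of a x] ab x' by (auto simp: S_def)
    qed
    moreover have "b \<in> S a" "b \<notin> S b" using ab by (auto simp: S_def)
    ultimately have "S b \<subset> S a" by blast
    moreover have "finite (S a)" using fin by (simp add: S_def)
    ultimately show ?thesis unfolding r_def by (rule psubset_card_mono[rotated])
  qed
  have iff: "c x y \<longleftrightarrow> r y < r x" if "x \<in> Y" "y \<in> Y" "x \<noteq> y" for x y
    using lt[of x y] lt[of y x] total[of x y] that by force
  have inj: "inj_on r Y"
    using iff total by (metis inj_onI less_irrefl)
  have "r ` Y \<subseteq> {..<card Y}"
  proof
    fix m assume "m \<in> r ` Y"
    then obtain a where a: "a \<in> Y" "m = r a" by auto
    then have "S a \<subset> Y" by (auto simp: S_def)
    then show "m \<in> {..<card Y}" using fin a psubset_card_mono by (auto simp: r_def)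
  qed
  moreover have "card (r ` Y) = card Y" using inj by (simp add: card_image)
  ultimately have "r ` Y = {..<card Y}" by (intro card_subset_eq) auto
  then show ?thesis using inj iff by (intro exI[of _ r]) (simp add: bij_betw_def)
qed

section \<open>Finding a straight-line pattern\<close>

context complete_bipartite_drawing
begin

definition sub_drawing :: "complex set \<Rightarrow> complex set \<Rightarrow> topgraph" where
  "sub_drawing A' B' = \<lparr> verts = A' \<union> B', edges = {E a b | a b. a \<in> A' \<and> b \<in> B'} \<rparr>"

lemma topological_subgraph_sub_drawing:
  assumes "A' \<subseteq> A" "B' \<subseteq> B"
  shows "topological_subgraph (sub_drawing A' B') G"
proof -
  have edges: "edges (sub_drawing A' B') \<subseteq> edges G" and verts: "verts (sub_drawing A' B') \<subseteq> verts G"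
    using assms edge parts by (auto simp: sub_drawing_def)
  have fin: "finite (verts G)" "finite (edges G)"
    using topological by (simp_all add: topological_graph_def)
  have cap: "E a b \<inter> verts (sub_drawing A' B') = {a, b}" if "a \<in> A'" "b \<in> B'" for a b
  proof -
    have *: "a \<in> A" "b \<in> B" using that assms by blast+
    have "E a b \<inter> verts (sub_drawing A' B') \<subseteq> {a, b}"
      unfolding E_verts[OF *, symmetric] using verts by blast
    moreover have "{a, b} \<subseteq> E a b \<inter> verts (sub_drawing A' B')"
      using edge[OF *] that by (simp add: sub_drawing_def)
    ultimately show ?thesis by (rule equalityI)
  qed
  have "topological_graph (sub_drawing A' B')"
    unfolding topological_graph_def
  proof (intro conjI ballI impI)
    show "finite (verts (sub_drawing A' B'))" "finite (edges (sub_drawing A' B'))"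
      using fin edges verts finite_subset by blast+
    fix e assume "e \<in> edges (sub_drawing A' B')"
    then obtain a b where e: "e = E a b" "a \<in> A'" "b \<in> B'" by (auto simp: sub_drawing_def)
    then have "a \<in> A" "b \<in> B" using assms by blast+
    then obtain g where g: "arc g" "path_image g = e" "pathstart g = a" "pathfinish g = b"
      using arc_E e(1) by (metis arc_between_def)
    show "\<exists>g. arc g \<and> path_image g = e \<and> e \<inter> verts (sub_drawing A' B') = {pathstart g, pathfinish g}"
      by (intro exI[of _ g] conjI g) (simp only: e(1) cap[OF e(2,3)] g(3,4))
    fix f p assume f: "f \<in> edges (sub_drawing A' B')" "e \<noteq> f" "p \<in> e \<inter> f - verts (sub_drawing A' B')"
    have "p \<notin> verts G"
    proof
      assume "p \<in> verts G"
      then have "p \<in> E a b \<inter> verts G" using f(3) e(1) by simp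
      then have "p \<in> {a, b}" by (simp only: E_verts[OF \<open>a \<in> A\<close> \<open>b \<in> B\<close>])
      then show False using f(3) e(2,3) by (auto simp: sub_drawing_def)
    qed
    then show "proper_crossing e f p"
      using topological f \<open>e \<in> edges (sub_drawing A' B')\<close> edges
      unfolding topological_graph_def by (metis DiffI DiffD1 subsetD)
  qed
  then show ?thesis
    unfolding topological_subgraph_def using topological edges verts by simp
qed

text \<open>
  The ranks \<open>r\<close> and \<open>q\<close> tell at which height each vertex is placed on its line. Edges with a common
  endpoint cross in neither graph, so only pairs of disjoint edges have to be compared.
\<close>

lemma weakly_isomorphic_C_graph:
  assumes sub: "A' \<subseteq> A" "B' \<subseteq> B"
    and r: "bij_betw r A' {..<s}" and q: "bij_betw q B' {..<t}"
    and cross: "\<And>a a' b b'. a \<in> A' \<Longrightarrow> a' \<in> A' \<Longrightarrow> b \<in> B' \<Longrightarrow> b' \<in> B' \<Longrightarrow> a \<noteq> a' \<Longrightarrow> b \<noteq> b' \<Longrightarrow>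
      edges_cross (E a b) (E a' b') \<longleftrightarrow> (real (r a) - real (r a')) * (real (q b) - real (q b')) < 0"
  shows "weakly_isomorphic (sub_drawing A' B') (C_graph s t)"
proof -
  define \<phi> where "\<phi> v = (if v \<in> A' then Complex 0 (real (r v)) else Complex 1 (real (q v)))" for v
  define F where "F = (\<lambda>(a, b). E a b)"
  define S where "S = (\<lambda>(a, b). seg (real (r a)) (real (q b)))"
  \<comment> \<open>Edges are compared through the pairs of their endpoints: \<open>F\<close> and \<open>S\<close> are injective.\<close>
  define \<psi> where "\<psi> = S \<circ> inv_into (A' \<times> B') F"
  have inr: "r a = r a' \<longleftrightarrow> a = a'" if "a \<in> A'" "a' \<in> A'" for a a'
    using that r by (auto simp: bij_betw_def inj_on_def)
  have inq: "q b = q b' \<longleftrightarrow> b = b'" if "b \<in> B'" "b' \<in> B'" for b b'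
    using that q by (auto simp: bij_betw_def inj_on_def)
  have rim: "r ` A' = {..<s}" and qim: "q ` B' = {..<t}"
    using r q by (simp_all add: bij_betw_def)
  have dis: "A' \<inter> B' = {}" using sub parts(3) by blast
  have \<phi>A: "\<phi> a = Complex 0 (real (r a))" if "a \<in> A'" for a using that by (simp add: \<phi>_def)
  have \<phi>B: "\<phi> b = Complex 1 (real (q b))" if "b \<in> B'" for b using that dis by (auto simp: \<phi>_def)
  have "\<phi> ` A' = (\<lambda>a. Complex 0 (real (r a))) ` A'" by (rule image_cong) (simp_all add: \<phi>A)
  also have "\<dots> = Complex 0 ` real ` r ` A'" by (simp add: image_image)
  finally have imA: "\<phi> ` A' = Complex 0 ` real ` {..<s}" by (simp add: rim)
  have "\<phi> ` B' = (\<lambda>b. Complex 1 (real (q b))) ` B'" by (rule image_cong) (simp_all add: \<phi>B)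
  also have "\<dots> = Complex 1 ` real ` q ` B'" by (simp add: image_image)
  finally have imB: "\<phi> ` B' = Complex 1 ` real ` {..<t}" by (simp add: qim)
  have bij\<phi>: "bij_betw \<phi> (verts (sub_drawing A' B')) (verts (C_graph s t))"
  proof (rule bij_betw_imageI)
    show "\<phi> ` verts (sub_drawing A' B') = verts (C_graph s t)"
      by (simp add: sub_drawing_def C_graph_def straight_bipartite_def image_Un imA imB)
    show "inj_on \<phi> (verts (sub_drawing A' B'))"
    proof (rule inj_onI)
      fix u v assume uv: "u \<in> verts (sub_drawing A' B')" "v \<in> verts (sub_drawing A' B')" "\<phi> u = \<phi> v"
      then have "u \<in> A' \<or> u \<in> B'" "v \<in> A' \<or> v \<in> B'" by (auto simp: sub_drawing_def)
      then show "u = v"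
        using uv(3) by (elim disjE) (simp_all add: \<phi>A \<phi>B inr inq)
    qed
  qed
  have Finj: "inj_on F (A' \<times> B')"
  proof (rule inj_onI)
    fix x y assume "x \<in> A' \<times> B'" "y \<in> A' \<times> B'" "F x = F y"
    then obtain a b a' b' where xy: "x = (a, b)" "y = (a', b')" "a \<in> A'" "b \<in> B'" "a' \<in> A'" "b' \<in> B'"
      and eq: "E a b = E a' b'"
      by (auto simp: F_def)
    then have "a \<in> A" "b \<in> B" "a' \<in> A" "b' \<in> B" using sub by blast+
    from E_inject[OF this eq] show "x = y" using xy by simp
  qed
  have Fim: "F ` (A' \<times> B') = edges (sub_drawing A' B')"
    by (auto simp: F_def sub_drawing_def)
  have Sinj: "inj_on S (A' \<times> B')"
  proof (rule inj_onI)
    fix x y assume "x \<in> A' \<times> B'" "y \<in> A' \<times> B'" "S x = S y"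
    then obtain a b a' b' where xy: "x = (a, b)" "y = (a', b')" "a \<in> A'" "b \<in> B'" "a' \<in> A'" "b' \<in> B'"
      and eq: "S (a, b) = S (a', b')"
      by blast
    from eq have "real (r a) = real (r a') \<and> real (q b) = real (q b')"
      by (simp only: S_def prod.case seg_inject)
    then show "x = y" using xy by (simp add: inr inq)
  qed
  have Sim: "S ` (A' \<times> B') = edges (C_graph s t)"
  proof -
    have "edges (C_graph s t) = (\<lambda>(y, z). seg (real y) (real z)) ` ({..<s} \<times> {..<t})"
      by (auto simp: C_graph_def straight_bipartite_def)
    also have "\<dots> = (\<lambda>(y, z). seg (real y) (real z)) ` map_prod r q ` (A' \<times> B')"
      by (simp add: map_prod_surj_on[OF rim qim])
    also have "\<dots> = S ` (A' \<times> B')"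
      unfolding image_image by (rule image_cong) (auto simp: S_def)
    finally show ?thesis ..
  qed
  have \<psi>: "\<psi> (E a b) = seg (real (r a)) (real (q b))" if "a \<in> A'" "b \<in> B'" for a b
  proof -
    have "inv_into (A' \<times> B') F (F (a, b)) = (a, b)"
      by (rule inv_into_f_f[OF Finj]) (simp add: that)
    then show ?thesis by (simp add: \<psi>_def F_def S_def)
  qed
  have bij\<psi>: "bij_betw \<psi> (edges (sub_drawing A' B')) (edges (C_graph s t))"
    unfolding \<psi>_def
  proof (rule bij_betw_trans)
    show "bij_betw (inv_into (A' \<times> B') F) (edges (sub_drawing A' B')) (A' \<times> B')"
      by (rule bij_betw_inv_into) (simp add: bij_betw_def Finj Fim)
    show "bij_betw S (A' \<times> B') (edges (C_graph s t))"
      by (simp add: bij_betw_def Sinj Sim)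
  qed
  show ?thesis
    unfolding weakly_isomorphic_def
  proof (intro exI[of _ \<phi>] exI[of _ \<psi>] conjI bij\<phi> bij\<psi> ballI impI)
    fix e assume "e \<in> edges (sub_drawing A' B')"
    then obtain a b where e: "e = E a b" "a \<in> A'" "b \<in> B'" by (auto simp: sub_drawing_def)
    have ab: "a \<in> A" "b \<in> B" using e sub by blast+
    {
      fix v assume v: "v \<in> verts (sub_drawing A' B')"
      have vG: "v \<in> verts G" using v sub parts by (auto simp: sub_drawing_def)
      have "v \<in> E a b \<longleftrightarrow> v \<in> E a b \<inter> verts G" using vG by simp
      also have "\<dots> \<longleftrightarrow> v = a \<or> v = b" by (simp only: E_verts[OF ab]) simp
      also have "\<dots> \<longleftrightarrow> \<phi> v \<in> \<psi> (E a b)"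
      proof (cases "v \<in> A'")
        case True
        then have "v \<noteq> b" using e dis by blast
        then show ?thesis using True e inr[OF True e(2)] by (simp add: \<phi>A \<psi> in_seg_iff)
      next
        case False
        then have vB: "v \<in> B'" using v by (simp add: sub_drawing_def)
        have "v \<noteq> a" using False e by blast
        then show ?thesis using vB e inq[OF vB e(3)] by (simp add: \<phi>B \<psi> in_seg_iff)
      qed
      finally show "v \<in> e \<longleftrightarrow> \<phi> v \<in> \<psi> e" by (simp only: e(1))
    }
    fix f assume "f \<in> edges (sub_drawing A' B')" and ne: "e \<noteq> f"
    then obtain a' b' where f: "f = E a' b'" "a' \<in> A'" "b' \<in> B'" by (auto simp: sub_drawing_def)
    have ab': "a' \<in> A" "b' \<in> B" using f sub by blast+
    have ne': "a \<noteq> a' \<or> b \<noteq> b'" using ne e f by blast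
    have "edges_cross (\<psi> e) (\<psi> f) \<longleftrightarrow> (real (r a) - real (r a')) * (real (q b) - real (q b')) < 0"
      unfolding e(1) f(1) \<psi>[OF e(2,3)] \<psi>[OF f(2,3)]
      by (rule seg_cross_iff) (use ne' inr[OF e(2) f(2)] inq[OF e(3) f(3)] in auto)
    also have "\<dots> \<longleftrightarrow> edges_cross e f"
    proof (cases "a \<noteq> a' \<and> b \<noteq> b'")
      case True
      then show ?thesis using cross[OF e(2) f(2) e(3) f(3)] by (simp add: e(1) f(1))
    next
      case False
      then have "\<not> edges_cross e f"
        unfolding e(1) f(1) using ne' by (intro adjacent_not_cross ab ab') blast
      then show ?thesis using False by auto
    qed
    finally show "edges_cross e f \<longleftrightarrow> edges_cross (\<psi> e) (\<psi> f)" ..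
  qed
qed

text \<open>
  If the crossings depend only on the relation \<open>c\<close> and on the order of the indices, then \<open>c\<close> satisfies
  the three restrictions and is a linear order on some \<open>k\<close> vertices. For \<open>i < j\<close> the edges
  \<open>a b\<^sub>i\<close> and \<open>a' b\<^sub>j\<close> of the straight-line graph cross iff \<open>a\<close> is above \<open>a'\<close>, so the vertices
  of \<open>A\<close> are placed by the number of their successors. Three indices are needed for the exclusion
  of \<open>K\<^bsub>3,3\<^esub>\<close>.
\<close>

theorem homogeneous_contains_C_graph:
  fixes \<beta> :: "nat \<Rightarrow> complex"
  assumes H: "finite H" "inj_on \<beta> H" "\<beta> ` H \<subseteq> B" "3 \<le> card H" "k \<le> card H"
    and A: "finite A" "k * (k + 1) \<le> 2 * card A"
    and hom: "\<And>i j a a'. i \<in> H \<Longrightarrow> j \<in> H \<Longrightarrow> i < j \<Longrightarrow> a \<in> A \<Longrightarrow> a' \<in> A \<Longrightarrow> a \<noteq> a' \<Longrightarrow>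
      edges_cross (E a (\<beta> i)) (E a' (\<beta> j)) \<longleftrightarrow> c a a'"
  shows "\<exists>K. topological_subgraph K G \<and> weakly_isomorphic K (C_graph k k)"
proof -
  obtain T where T: "T \<subseteq> H" "card T = 3" using H(4) by (meson obtain_subset_with_card_n)
  then obtain i1 i2 i3 where T3: "T = {i1, i2, i3}" "i1 \<noteq> i2" "i1 \<noteq> i3" "i2 \<noteq> i3"
    unfolding card_3_iff by metis
  have iH: "i1 \<in> H" "i2 \<in> H" "i3 \<in> H" using T(1) T3(1) by simp_all
  have \<beta>B: "\<beta> i \<in> B" if "i \<in> H" for i using that H(3) by blast
  have \<beta>ne: "\<beta> i \<noteq> \<beta> j" if "i \<in> H" "j \<in> H" "i \<noteq> j" for i j
    using that H(2) by (auto dest: inj_onD)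
  \<comment> \<open>One pair of indices is enough to read off all of \<open>c\<close>.\<close>
  obtain l m where lm: "l \<in> H" "m \<in> H" "l < m"
    using iH T3(2) by (metis linorder_neqE_nat)
  note lm' = \<beta>B[OF lm(1)] \<beta>B[OF lm(2)]
  have lm_ne: "\<beta> l \<noteq> \<beta> m" using \<beta>ne[OF lm(1,2)] lm(3) by simp
  have cr: "c a a' \<longleftrightarrow> edges_cross (E a (\<beta> l)) (E a' (\<beta> m))" if "a \<in> A" "a' \<in> A" "a \<noteq> a'" for a a'
    using hom[OF lm that] by simp
  have asym: "\<not> (c a a' \<and> c a' a)" if a: "a \<in> A" "a' \<in> A" "a \<noteq> a'" for a a'
    using crossings_antisymmetric[OF a(1,2) lm' a(3) lm_ne] cr[OF a] cr[OF a(2,1) a(3)[symmetric]]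
    by blast
  have acyc: "\<not> (c x y \<and> c y z \<and> c z x)"
    if x: "x \<in> A" "y \<in> A" "z \<in> A" "x \<noteq> y" "x \<noteq> z" "y \<noteq> z" for x y z
    using crossings_acyclic[OF x lm' lm_ne] cr[OF x(1,2,4)] cr[OF x(2,3,6)] cr[OF x(3,1) x(5)[symmetric]]
    by blast
  have indep: "(c x y \<or> c y x) \<or> (c x z \<or> c z x) \<or> (c y z \<or> c z y)"
    if xyz: "x \<in> A" "y \<in> A" "z \<in> A" "x \<noteq> y" "x \<noteq> z" "y \<noteq> z" for x y z
  proof -
    obtain a a' b b' where ab: "a \<in> {x,y,z}" "a' \<in> {x,y,z}" "b \<in> {\<beta> i1, \<beta> i2, \<beta> i3}" "b' \<in> {\<beta> i1, \<beta> i2, \<beta> i3}"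
      "a \<noteq> a'" "b \<noteq> b'" "edges_cross (E a b) (E a' b')"
      using some_crossing[OF xyz \<beta>B[OF iH(1)] \<beta>B[OF iH(2)] \<beta>B[OF iH(3)]
          \<beta>ne[OF iH(1,2) T3(2)] \<beta>ne[OF iH(1,3) T3(3)] \<beta>ne[OF iH(2,3) T3(4)]]
      by (elim bexE conjE) (rule that; assumption)
    have aA: "a \<in> A" "a' \<in> A" using ab(1,2) xyz by auto
    obtain i where i: "i \<in> H" "b = \<beta> i" using ab(3) iH by blast
    obtain j where j: "j \<in> H" "b' = \<beta> j" using ab(4) iH by blast
    note ij = i(1) j(1) i(2) j(2)
    then have "i \<noteq> j" using ab(6) by blast
    then have "c a a' \<or> c a' a"
    proof (cases "i < j")
      case True
      then show ?thesis using hom[OF ij(1,2) True aA ab(5)] ab(7) ij by simp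
    next
      case False
      then have "j < i" using \<open>i \<noteq> j\<close> by simp
      then show ?thesis
        using hom[OF ij(2,1) \<open>j < i\<close> aA(2,1)] ab(5,7) ij edges_cross_commute by metis
    qed
    then show ?thesis using ab(1,2,5) by auto
  qed
  have "\<exists>Y\<subseteq>A. card Y = k \<and> (\<forall>x\<in>Y. \<forall>y\<in>Y. x \<noteq> y \<longrightarrow> c x y \<or> c y x)"
    by (rule clique_of_no_independent_triple[OF A]) (use indep in blast)+
  then obtain A' where A': "A' \<subseteq> A" "card A' = k"
    and tot: "\<forall>x\<in>A'. \<forall>y\<in>A'. x \<noteq> y \<longrightarrow> c x y \<or> c y x" by blast
  have finA': "finite A'" using A' A(1) finite_subset by blast
  have "\<exists>r :: complex \<Rightarrow> nat. bij_betw r A' {..<card A'} \<and>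
    (\<forall>x\<in>A'. \<forall>y\<in>A'. x \<noteq> y \<longrightarrow> (c x y \<longleftrightarrow> r y < r x))"
    by (rule acyclic_tournament_rank[OF finA']; use tot asym acyc A'(1) in blast)
  then obtain r :: "complex \<Rightarrow> nat" where r: "bij_betw r A' {..<card A'}"
    "\<forall>x\<in>A'. \<forall>y\<in>A'. x \<noteq> y \<longrightarrow> (c x y \<longleftrightarrow> r y < r x)" by blast
  obtain H' where H': "H' \<subseteq> H" "card H' = k" using H(5) by (meson obtain_subset_with_card_n)
  define B' where "B' = \<beta> ` H'"
  \<comment> \<open>The vertices of \<open>B\<close> are placed in the order of their indices.\<close>
  define idx where "idx = inv_into H \<beta>"
  have idx: "idx (\<beta> i) = i" if "i \<in> H" for i
    unfolding idx_def using that H(2) by (simp add: inv_into_f_f)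
  have B'B: "B' \<subseteq> B" using H' H(3) by (auto simp: B'_def)
  have finB': "finite B'" using H(1) H'(1) finite_subset by (auto simp: B'_def)
  have cardB': "card B' = k"
    unfolding B'_def using H' H(2) by (metis card_image inj_on_subset)
  have in_B': "idx b \<in> H" "\<beta> (idx b) = b" if "b \<in> B'" for b
    using that H'(1) idx by (auto simp: B'_def)
  have idx_ne: "idx b \<noteq> idx b'" if "b \<in> B'" "b' \<in> B'" "b \<noteq> b'" for b b'
    using in_B'(2)[OF that(1)] in_B'(2)[OF that(2)] that(3) by metis
  have "\<exists>q :: complex \<Rightarrow> nat. bij_betw q B' {..<card B'} \<and>
    (\<forall>x\<in>B'. \<forall>y\<in>B'. x \<noteq> y \<longrightarrow> (idx y < idx x \<longleftrightarrow> q y < q x))"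
  proof (rule acyclic_tournament_rank[OF finB'])
    fix x y assume "x \<in> B'" "y \<in> B'" "x \<noteq> y"
    from idx_ne[OF this] show "idx y < idx x \<or> idx x < idx y" by linarith
  qed linarith+
  then obtain q :: "complex \<Rightarrow> nat" where q: "bij_betw q B' {..<card B'}"
    "\<forall>x\<in>B'. \<forall>y\<in>B'. x \<noteq> y \<longrightarrow> (idx y < idx x \<longleftrightarrow> q y < q x)" by blast
  have cross: "edges_cross (E a b) (E a' b') \<longleftrightarrow> (real (r a) - real (r a')) * (real (q b) - real (q b')) < 0"
    if "a \<in> A'" "a' \<in> A'" "b \<in> B'" "b' \<in> B'" "a \<noteq> a'" "b \<noteq> b'" for a a' b b'
  proof -
    have less: "edges_cross (E a b) (E a' b') \<longleftrightarrow> (real (r a) - real (r a')) * (real (q b) - real (q b')) < 0"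
      if ab: "a \<in> A'" "a' \<in> A'" "b \<in> B'" "b' \<in> B'" "a \<noteq> a'" "b \<noteq> b'" and lt: "idx b < idx b'" for a a' b b'
    proof -
      have q_less: "q b < q b'" using q(2) ab(3,4,6) lt by metis
      have "a \<in> A" "a' \<in> A" using ab A' by blast+
      then have "edges_cross (E a b) (E a' b') \<longleftrightarrow> c a a'"
        using hom[OF in_B'(1)[OF ab(3)] in_B'(1)[OF ab(4)] lt] in_B'(2)[OF ab(3)] in_B'(2)[OF ab(4)] ab(5)
        by simp
      also have "\<dots> \<longleftrightarrow> r a' < r a" using r(2) ab by blast
      also have "\<dots> \<longleftrightarrow> (real (r a) - real (r a')) * (real (q b) - real (q b')) < 0"
        using q_less by (simp add: mult_less_0_iff)
      finally show ?thesis .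
    qed
    show ?thesis
    proof (cases "idx b < idx b'")
      case True
      then show ?thesis by (rule less[OF that])
    next
      case False
      then have "idx b' < idx b" using idx_ne[OF that(3,4,6)] by simp
      then have "edges_cross (E a' b') (E a b) \<longleftrightarrow> (real (r a') - real (r a)) * (real (q b') - real (q b)) < 0"
        using less[OF that(2,1,4,3)] that(5,6) by simp
      then show ?thesis by (subst edges_cross_commute) (simp add: algebra_simps)
    qed
  qed
  show ?thesis
  proof (intro exI conjI)
    show "topological_subgraph (sub_drawing A' B') G"
      by (rule topological_subgraph_sub_drawing[OF A'(1) B'B])
    show "weakly_isomorphic (sub_drawing A' B') (C_graph k k)"
      by (rule weakly_isomorphic_C_graph[OF A'(1) B'B _ _ cross])
        (use r(1) q(1) A'(2) cardB' in simp_all)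
  qed
qed

end

definition joined :: "topgraph \<Rightarrow> complex \<Rightarrow> complex \<Rightarrow> bool" where
  "joined G u v \<longleftrightarrow> u \<noteq> v \<and> (\<exists>e\<in>edges G. u \<in> e \<and> v \<in> e)"

text \<open>
  A simple topological graph has no parallel edges, as these would share two points.
\<close>

lemma card_edges_le_sum_degrees:
  assumes G: "simple_topological_graph G"
  shows "card (edges G) \<le> (\<Sum>v\<in>verts G. card {u \<in> verts G. joined G v u})"
proof -
  have top: "topological_graph G" using G by (simp add: simple_topological_graph_def)
  have fin: "finite (verts G)" using top by (simp add: topological_graph_def)
  define P where "P = (SIGMA v:verts G. {u \<in> verts G. joined G v u})"
  define F where "F p = (SOME e. e \<in> edges G \<and> fst p \<in> e \<and> snd p \<in> e)" for p
  have "edges G \<subseteq> F ` P"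
  proof
    fix e assume e: "e \<in> edges G"
    have "\<exists>g. arc g \<and> path_image g = e \<and> e \<inter> verts G = {pathstart g, pathfinish g}"
      using top e by (simp add: topological_graph_def)
    then obtain g where g: "arc g" "e \<inter> verts G = {pathstart g, pathfinish g}" by (elim exE conjE)
    define u v where "u = pathstart g" and "v = pathfinish g"
    have ne: "u \<noteq> v" using arc_distinct_ends[OF g(1)] by (simp add: u_def v_def)
    have "u \<in> e \<inter> verts G" "v \<in> e \<inter> verts G" unfolding g(2) by (simp_all add: u_def v_def)
    then have uv: "u \<in> e" "v \<in> e" "u \<in> verts G" "v \<in> verts G" by simp_all
    have inP: "(u, v) \<in> P" using uv ne e by (auto simp: P_def joined_def)
    have "F (u, v) \<in> edges G \<and> fst (u, v) \<in> F (u, v) \<and> snd (u, v) \<in> F (u, v)"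
      unfolding F_def by (rule someI[of _ e]) (use e uv in simp)
    then have F: "F (u, v) \<in> edges G" "u \<in> F (u, v)" "v \<in> F (u, v)" by simp_all
    have all: "\<forall>e\<in>edges G. \<forall>f\<in>edges G. e \<noteq> f \<longrightarrow> (\<forall>p \<in> e \<inter> f. \<forall>q \<in> e \<inter> f. p = q)"
      using G unfolding simple_topological_graph_def by (rule conjunct2)
    have "F (u, v) = e"
    proof (rule ccontr)
      assume "F (u, v) \<noteq> e"
      from all[rule_format, OF F(1) e this, of u v] show False using F uv ne by simp
    qed
    then show "e \<in> F ` P" using inP by (metis image_eqI)
  qed
  moreover have "finite P" using fin by (simp add: P_def)
  ultimately have "card (edges G) \<le> card P" by (rule surj_card_le[rotated])
  also have "card P = (\<Sum>v\<in>verts G. card {u \<in> verts G. joined G v u})"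
    unfolding P_def using fin by (simp add: card_SigmaI)
  finally show ?thesis .
qed

text \<open>
  The colour of a pair of indices is the crossing relation between the two stars, a subset of
  \<open>A \<times> A\<close>; so the number \<open>2\<^bsup>s * s\<^esup>\<close> of colours, and with it \<open>N\<close>, depends on \<open>s\<close> and \<open>k\<close> only.
\<close>

lemma C_graph_of_large_bipartite:
  fixes k s :: nat
  assumes k: "k * (k + 1) \<le> 2 * s"
  shows "\<exists>N::nat. \<forall>G A B. simple_topological_graph G \<longrightarrow> A \<subseteq> verts G \<longrightarrow> B \<subseteq> verts G \<longrightarrow>
    card A = s \<longrightarrow> card B = N \<longrightarrow> (\<forall>a\<in>A. \<forall>b\<in>B. joined G b a) \<longrightarrow>
    (\<exists>K. topological_subgraph K G \<and> weakly_isomorphic K (C_graph k k))"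
proof -
  from ramsey_pairs obtain N :: nat where N:
    "\<forall>(K :: (complex \<times> complex) set set) f. finite K \<longrightarrow> card K = 2 ^ (s * s) \<longrightarrow>
      (\<forall>i j. i < j \<longrightarrow> j < N \<longrightarrow> f i j \<in> K) \<longrightarrow>
      (\<exists>H c. H \<subseteq> {..<N} \<and> card H = max 3 k \<and> (\<forall>i\<in>H. \<forall>j\<in>H. i < j \<longrightarrow> f i j = c))" ..
  show ?thesis
  proof (intro exI[of _ N] allI impI)
    fix G A B
    assume G: "simple_topological_graph G" and sub: "A \<subseteq> verts G" "B \<subseteq> verts G"
      and card: "card A = s" "card B = N" and jn: "\<forall>a\<in>A. \<forall>b\<in>B. joined G b a"
    have "finite (verts G)"
      using G by (simp add: simple_topological_graph_def topological_graph_def)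
    then have fin: "finite A" "finite B" using sub finite_subset by blast+
    define E where "E a b = (SOME e. e \<in> edges G \<and> a \<in> e \<and> b \<in> e)" for a b
    have E: "E a b \<in> edges G \<and> a \<in> E a b \<and> b \<in> E a b" if ab: "a \<in> A" "b \<in> B" for a b
    proof -
      have "\<exists>e. e \<in> edges G \<and> a \<in> e \<and> b \<in> e" using jn ab unfolding joined_def by blast
      then show ?thesis unfolding E_def by (rule someI_ex)
    qed
    have disj: "A \<inter> B = {}" using jn unfolding joined_def by blast
    interpret complete_bipartite_drawing G A B E
      by unfold_locales (fact G sub disj E)+
    obtain \<beta> where \<beta>: "bij_betw \<beta> {..<N} B"
      using ex_bij_betw_nat_finite[OF fin(2)] card(2) by (auto simp: atLeast0LessThan)
    define f where "f i j = {(a, a') \<in> A \<times> A. edges_cross (E a (\<beta> i)) (E a' (\<beta> j))}" for i j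
    have "\<exists>H c. H \<subseteq> {..<N} \<and> card H = max 3 k \<and> (\<forall>i\<in>H. \<forall>j\<in>H. i < j \<longrightarrow> f i j = c)"
    proof (rule N[rule_format, of "Pow (A \<times> A)"])
      show "finite (Pow (A \<times> A))" using fin by simp
      show "card (Pow (A \<times> A)) = 2 ^ (s * s)"
        using fin card by (simp add: card_Pow card_cartesian_product)
      show "f i j \<in> Pow (A \<times> A)" for i j unfolding f_def by blast
    qed
    then obtain H c where H: "H \<subseteq> {..<N}" "card H = max 3 k"
      and c: "\<forall>i\<in>H. \<forall>j\<in>H. i < j \<longrightarrow> f i j = c" by (elim exE conjE)
    show "\<exists>K. topological_subgraph K G \<and> weakly_isomorphic K (C_graph k k)"
    proof (rule homogeneous_contains_C_graph[of H \<beta>])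
      show "finite H" using H(1) finite_subset by blast
      show "inj_on \<beta> H" "\<beta> ` H \<subseteq> B"
        using \<beta> H(1) inj_on_subset unfolding bij_betw_def by blast+
      show "3 \<le> card H" "k \<le> card H" using H(2) by simp_all
      show "finite A" "k * (k + 1) \<le> 2 * card A" using fin k card by simp_all
      fix i j a a' assume ij: "i \<in> H" "j \<in> H" "i < j" and a: "a \<in> A" "a' \<in> A" "a \<noteq> a'"
      have "edges_cross (E a (\<beta> i)) (E a' (\<beta> j)) \<longleftrightarrow> (a, a') \<in> f i j"
        using a by (simp add: f_def)
      then show "edges_cross (E a (\<beta> i)) (E a' (\<beta> j)) \<longleftrightarrow> (a, a') \<in> c"
        using c[rule_format, OF ij] by (simp only:)
    qed
  qed
qed

theorem theorem1p3:
  fixes k :: nat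
  assumes "k \<ge> 1"
  shows "\<exists>c::real. \<forall>n::nat. n \<ge> 1 \<longrightarrow>
    (\<forall>G. simple_topological_graph G \<and> card (verts G) = n \<and>
         \<not> (\<exists>H. topological_subgraph H G \<and> weakly_isomorphic H (C_graph k k)) \<longrightarrow>
         real (card (edges G)) \<le> c * real n powr (2 - 1 / (2 * (real k - 1) ^ 4 + 1)))"
proof -
  define s :: nat where "s = 2 * (k - 1) ^ 4 + 1"
  have s1: "s \<ge> 1" by (simp add: s_def)
  have sr: "real s = 2 * (real k - 1) ^ 4 + 1" using assms by (simp add: s_def of_nat_diff)
  have ks: "k * (k + 1) \<le> 2 * s"
  proof -
    obtain j where j: "k = Suc j" using assms by (cases k) auto
    have "j \<le> j ^ 4" by (cases "j = 0") (simp_all add: self_le_power)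
    moreover have "j ^ 2 \<le> j ^ 4" by (cases "j = 0") (simp_all add: power_increasing)
    moreover have "k * (k + 1) = j ^ 2 + 3 * j + 2" unfolding j by (simp add: power2_eq_square)
    moreover have "2 * s = 4 * j ^ 4 + 2" by (simp add: s_def j)
    ultimately show ?thesis by linarith
  qed
  from C_graph_of_large_bipartite[OF ks] obtain N :: nat where N:
    "\<forall>G A B. simple_topological_graph G \<longrightarrow> A \<subseteq> verts G \<longrightarrow> B \<subseteq> verts G \<longrightarrow>
      card A = s \<longrightarrow> card B = N \<longrightarrow> (\<forall>a\<in>A. \<forall>b\<in>B. joined G b a) \<longrightarrow>
      (\<exists>K. topological_subgraph K G \<and> weakly_isomorphic K (C_graph k k))" ..
  show ?thesis
  proof (intro exI[of _ "s * real (N + 1) powr (1 / s)"] allI impI, elim conjE)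
    fix n :: nat and G
    assume n: "n \<ge> 1" and G: "simple_topological_graph G" "card (verts G) = n"
      and no: "\<not> (\<exists>H. topological_subgraph H G \<and> weakly_isomorphic H (C_graph k k))"
    have fin: "finite (verts G)" "verts G \<noteq> {}"
      using G n by (auto simp: simple_topological_graph_def topological_graph_def)
    have free: "card {v \<in> verts G. \<forall>a\<in>A. joined G v a} \<le> N" if A: "A \<subseteq> verts G" "card A = s" for A
    proof (rule ccontr)
      assume "\<not> ?thesis"
      then have "N \<le> card {v \<in> verts G. \<forall>a\<in>A. joined G v a}" by simp
      then obtain B where B: "B \<subseteq> {v \<in> verts G. \<forall>a\<in>A. joined G v a}" "card B = N"
        by (meson obtain_subset_with_card_n)
      have "B \<subseteq> verts G" "\<forall>a\<in>A. \<forall>b\<in>B. joined G b a" using B(1) by blast+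
      then show False
        using N[rule_format, OF G(1) A(1) _ A(2) B(2)] no by simp
    qed
    have "real (card (edges G)) \<le> real (\<Sum>v\<in>verts G. card {u \<in> verts G. joined G v u})"
      using card_edges_le_sum_degrees[OF G(1)] by (rule of_nat_mono)
    also have "\<dots> \<le> s * real (N + 1) powr (1 / s) * card (verts G) powr (2 - 1 / s)"
      by (rule kovari_sos_turan[OF fin s1 free])
    finally show "real (card (edges G)) \<le>
        s * real (N + 1) powr (1 / s) * real n powr (2 - 1 / (2 * (real k - 1) ^ 4 + 1))"
      by (simp only: G(2) sr)
  qed
qed

end
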